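(* If $\varphi$ is in the maximal ideal space $\mathfrak{M}(A_{0}+AP_{+})$, then one of the following three statements holds: (a) There exists $s\in\mathbb{C}_{\geq 0}$ such that $\varphi(f)=f(s)$ for all $f\in A_{0}+AP_{+}$. (b) $\varphi=\underline{+\infty}$, that is, $\varphi(f)=\underline{+\infty}(f):=\lim_{s\to+\infty}f(s)=f_{0}$ (limit along real $s\to+\infty$) for all $f=f_{A_0}+\sum_{k\geq 0}f_k e^{-\,\cdot\, t_k}\in A_0+AP_+$, where $f_{A_0}\in A_0$. (c) There exist $\sigma\geq 0$ and a character $\chi$ such that $\varphi(f)=\sum_{k\geq 0}f_k e^{-\sigma t_k}\chi(t_k)$ for all $f=f_{A_0}+\sum_{k\geq 0}f_k e^{-\,\cdot\, t_k}\in A_0+AP_+$, where $f_{A_0}\in A_0$.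
   Context: $\mathbb{C}_{\geq 0}=\{s\in\mathbb{C}:\operatorname{Re}(s)\geq 0\}$ and $\mathbb{C}_{>0}=\{s\in\mathbb{C}:\operatorname{Re}(s)>0\}$. $A_{0}$ is the set of functions $f:\mathbb{C}_{\geq 0}\to\mathbb{C}$ that are holomorphic in $\mathbb{C}_{>0}$, continuous on $\mathbb{C}_{\geq 0}$, and satisfy $\lim_{s\to\infty}f(s)=0$ (limit as $|s|\to\infty$ in $\mathbb{C}_{\geq 0}$). $AP_{+}$ (causal almost periodic functions) is the closure, in the supremum norm on $\mathbb{C}_{\geq 0}$, of the complex linear span of the functions $s\mapsto e^{-st}$, $t\geq 0$. $A_{0}+AP_{+}=\{f:\mathbb{C}_{\geq 0}\to\mathbb{C}: f=f_{A_0}+f_{AP_+},\ f_{A_0}\in A_0,\ f_{AP_+}\in AP_+\}$ is a Banach algebra with pointwise operations and the supremum norm. $\mathfrak{M}(A_{0}+AP_{+})$ is its maximal ideal space: the set of nonzero complex algebra homomorphisms $A_0+AP_+\to\mathbb{C}$, with the weak-$*$ topology. A character is a function $\chi:\mathbb{R}\to\mathbb{C}$ (no continuity required) with $|\chi(t)|=1$ and $\chi(t+\tau)=\chi(t)\chi(\tau)$ for all $t,\tau\in\mathbb{R}$. Elements of $AP_+$ are written as (generalized Fourier) series $f_{AP_+}(s)=\sum_{k\geq 0}f_k e^{-st_k}$ with $t_0=0<t_1,t_2,\ldots$; in particular $f_0$ is the coefficient of the exponent $0$. For exponential polynomials (finite sums) the expression $\sum_k f_k e^{-\sigma t_k}\chi(t_k)$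 in (c) is taken literally; for a general element of $AP_+$ it denotes the value of the unique supremum-norm-continuous extension to $AP_+$ of the functional $\sum_k f_k e^{-\,\cdot\, t_k}\mapsto\sum_k f_k e^{-\sigma t_k}\chi(t_k)$ defined on exponential polynomials. *)

theory Defs
  imports "HOL-Analysis.Analysis"
begin

text \<open>
  A function on a set \<open>S\<close> is represented by an element of \<^term>\<open>extensional S\<close>, so functions
  on the closed half plane, and functionals on an algebra of such functions, are equal as soon
  as they agree on their domain.
\<close>

definition closed_rhp :: "complex set" where
  "closed_rhp = {s. 0 \<le> Re s}"

definition open_rhp :: "complex set" where
  "open_rhp = {s. 0 < Re s}"

definition A0 :: "(complex \<Rightarrow> complex) set" where
  "A0 = {f \<in> extensional closed_rhp.
           f holomorphic_on open_rhp \<and>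
           continuous_on closed_rhp f \<and>
           (f \<longlongrightarrow> 0) (inf at_infinity (principal closed_rhp))}"

definition exp_poly :: "real set \<Rightarrow> (real \<Rightarrow> complex) \<Rightarrow> complex \<Rightarrow> complex" where
  "exp_poly K c = (\<lambda>s\<in>closed_rhp. \<Sum>t\<in>K. c t * exp (- (s * of_real t)))"

definition exp_polys :: "(complex \<Rightarrow> complex) set" where
  "exp_polys = {exp_poly K c | K c. finite K \<and> K \<subseteq> {0..}}"

text \<open>
  \<^term>\<open>funspace S m\<close> is the metric space of bounded extensional functions on \<open>S\<close> with the
  supremum metric.
\<close>

definition sup_norm_topology :: "(complex \<Rightarrow> complex) topology" where
  "sup_norm_topology = mtopology_of (funspace closed_rhp euclidean_metric)"

definition AP_plus :: "(complex \<Rightarrow> complex) set" where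
  "AP_plus = sup_norm_topology closure_of exp_polys"

definition A0_AP_plus :: "(complex \<Rightarrow> complex) set" where
  "A0_AP_plus = {(\<lambda>s\<in>closed_rhp. g s + h s) | g h. g \<in> A0 \<and> h \<in> AP_plus}"

definition nonzero_hom :: "'a set \<Rightarrow> ('a \<Rightarrow> complex) set \<Rightarrow> (('a \<Rightarrow> complex) \<Rightarrow> complex) \<Rightarrow> bool" where
  "nonzero_hom S A \<phi> \<longleftrightarrow>
     (\<forall>f\<in>A. \<forall>g\<in>A. \<phi> (\<lambda>s\<in>S. f s + g s) = \<phi> f + \<phi> g) \<and>
     (\<forall>c. \<forall>f\<in>A. \<phi> (\<lambda>s\<in>S. c * f s) = c * \<phi> f) \<and>
     (\<forall>f\<in>A. \<forall>g\<in>A. \<phi> (\<lambda>s\<in>S. f s * g s) = \<phi> f * \<phi> g) \<and>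
     (\<exists>f\<in>A. \<phi> f \<noteq> 0)"

text \<open>
  The weak-* topology is that of pointwise convergence on \<open>A\<close>. The points of the product
  space are exactly the functionals in \<^term>\<open>extensional A\<close>.
\<close>

definition maximal_ideal_space ::
    "'a set \<Rightarrow> ('a \<Rightarrow> complex) set \<Rightarrow> (('a \<Rightarrow> complex) \<Rightarrow> complex) topology" where
  "maximal_ideal_space S A =
     subtopology (product_topology (\<lambda>_. euclidean) A) {\<phi>. nonzero_hom S A \<phi>}"

definition real_character :: "(real \<Rightarrow> complex) \<Rightarrow> bool" where
  "real_character \<xi> \<longleftrightarrow> (\<forall>t. cmod (\<xi> t) = 1) \<and> (\<forall>t \<tau>. \<xi> (t + \<tau>) = \<xi> t * \<xi> \<tau>)"

text \<open>
  The coefficient of \<open>e\<^sup>-\<^sup>s\<^sup>t\<close> in the generalized Fourier series of \<open>h\<close>, given by the Bohr mean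
  of \<open>\<omega> \<mapsto> h (\<i>\<omega>) e\<^sup>\<i>\<^sup>\<omega>\<^sup>t\<close> over the imaginary axis.
\<close>

definition fourier_coeff :: "(complex \<Rightarrow> complex) \<Rightarrow> real \<Rightarrow> complex" where
  "fourier_coeff h t =
     Lim at_top (\<lambda>T::real.
       integral {-T..T} (\<lambda>\<omega>. h (\<i> * of_real \<omega>) * exp (\<i> * of_real (\<omega> * t))) / of_real (2 * T))"

definition plus_infinity :: "(complex \<Rightarrow> complex) \<Rightarrow> complex" where
  "plus_infinity = (\<lambda>f\<in>A0_AP_plus. Lim at_top (\<lambda>x::real. f (of_real x)))"

text \<open>
  The expression \<open>\<Sum>k. f\<^sub>k e\<^sup>-\<^sup>\<sigma>\<^sup>t\<^sub>k \<xi>(t\<^sub>k)\<close>, as a functional of \<open>f\<close>: literal on exponential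
  polynomials, and extended to \<^term>\<open>AP_plus\<close> by continuity in the supremum norm.
\<close>

definition is_twisted_eval ::
    "real \<Rightarrow> (real \<Rightarrow> complex) \<Rightarrow> ((complex \<Rightarrow> complex) \<Rightarrow> complex) \<Rightarrow> bool" where
  "is_twisted_eval \<sigma> \<xi> \<Lambda> \<longleftrightarrow>
     \<Lambda> \<in> extensional AP_plus \<and>
     continuous_map (subtopology sup_norm_topology AP_plus) euclidean \<Lambda> \<and>
     (\<forall>K c. finite K \<and> K \<subseteq> {0..} \<longrightarrow>
        \<Lambda> (exp_poly K c) = (\<Sum>t\<in>K. c t * of_real (exp (- (\<sigma> * t))) * \<xi> t))"

definition twisted_eval :: "real \<Rightarrow> (real \<Rightarrow> complex) \<Rightarrow> (complex \<Rightarrow> complex) \<Rightarrow> complex" where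
  "twisted_eval \<sigma> \<xi> = (THE \<Lambda>. is_twisted_eval \<sigma> \<xi> \<Lambda>)"

end

theory Submission
  imports Defs "HOL-Complex_Analysis.Cauchy_Integral_Formula"
begin

text \<open>
  The two summands behave differently: \<open>A0\<close> is an ideal of the algebra, and a homomorphism \<open>\<phi>\<close>
  either sees it or kills it.

  Suppose \<open>\<phi>\<close> is nonzero on \<open>A0\<close>. The coordinate \<open>s\<close> is not in the algebra, but its
  resolvents \<open>1 / (s - w)\<close> with \<open>Re w < 0\<close> are in \<open>A0\<close>, and \<open>\<phi>\<close> respects the resolvent identity
  between them. So the single number \<open>\<phi> (1 / (s + 1))\<close> determines a candidate point \<open>a\<close>, namely the
  one with \<open>\<phi> (1 / (s + 1)) = 1 / (a + 1)\<close>; it lies in the closed half plane. To see that \<open>\<phi>\<close> is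
  evaluation at \<open>a\<close> it is enough that \<open>\<phi> f = 0\<close> whenever \<open>f a = 0\<close>. At an interior
  point this is division by \<open>s - a\<close> (lemma \<open>hom_zero_at_interior_root\<close>). At a boundary point \<open>f\<close>
  is multiplied by \<open>x / (s - a + x)\<close>, \<open>x > 0\<close>: this has \<open>\<phi>\<close>-value 1 and concentrates at \<open>a\<close> as
  \<open>x\<close> tends to 0, so the product tends uniformly to 0 while its \<open>\<phi>\<close>-value stays \<open>\<phi> f\<close> (lemma
  \<open>hom_zero_at_boundary_root\<close>). The value \<open>\<phi> (1 / (s + 1)) = 0\<close> stands for the point at infinity,
  where \<open>A0\<close> vanishes, and is excluded in this case (lemma \<open>hom_vanishes_on_A0\<close>). Since \<open>A0\<close> is an
  ideal, knowing \<open>\<phi>\<close> on \<open>A0\<close> means knowing it everywhere.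

  Suppose \<open>\<phi>\<close> is zero on \<open>A0\<close>. Then it is determined by its restriction to \<open>AP_plus\<close>, and, being
  continuous there, by \<open>m t = \<phi> (e\<^sup>-\<^sup>s\<^sup>t)\<close> for \<open>t \<ge> 0\<close>. This function is multiplicative and
  bounded by 1. If it has no zero, then \<open>- ln \<bar>m\<bar>\<close> is additive and nonnegative, hence linear, which
  gives \<open>\<sigma>\<close>, and the phase of \<open>m\<close> gives the character. If it has a zero, then it vanishes at all
  positive \<open>t\<close>, so \<open>\<phi>\<close> extracts the constant coefficient; on exponential polynomials this is both
  the Bohr mean and the limit at \<open>+\<infinity>\<close>, and uniform approximation carries this over to \<open>AP_plus\<close>.

  The continuity used in both cases is contractivity on each summand: \<open>\<phi> f\<close> cannot be a number
  \<open>l\<close> with \<open>\<bar>l\<bar>\<close> above the supremum of \<open>\<bar>f\<bar>\<close>, because then the quasi-inverse \<open>f / (l - f)\<close> is in the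
  same summand as \<open>f\<close> (lemmas \<open>hom_contractive_A0\<close> and \<open>hom_contractive_AP_plus\<close>).
\<close>

section \<open>The algebra of causal almost periodic functions\<close>

lemma closed_rhp_iff [simp]: "s \<in> closed_rhp \<longleftrightarrow> 0 \<le> Re s"
  by (simp add: closed_rhp_def)

lemma open_rhp_iff [simp]: "s \<in> open_rhp \<longleftrightarrow> 0 < Re s"
  by (simp add: open_rhp_def)

lemma closed_rhp_nonempty: "closed_rhp \<noteq> {}"
  using closed_rhp_iff [of 0] by fastforce

lemma open_open_rhp: "open open_rhp"
  unfolding open_rhp_def by (rule open_halfspace_Re_gt)

lemma exp_poly_apply:
  "0 \<le> Re s \<Longrightarrow> exp_poly K c s = (\<Sum>t\<in>K. c t * exp (- (s * of_real t)))"
  by (simp add: exp_poly_def)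

lemma norm_exp_monomial_le:
  "\<lbrakk>0 \<le> Re s; 0 \<le> t\<rbrakk> \<Longrightarrow> cmod (exp (- (s * of_real t))) \<le> 1"
  by (simp add: norm_exp_eq_Re)

lemma exp_polysI: "\<lbrakk>finite K; K \<subseteq> {0..}\<rbrakk> \<Longrightarrow> exp_poly K c \<in> exp_polys"
  unfolding exp_polys_def by blast

lemma exp_polys_extensional: "p \<in> exp_polys \<Longrightarrow> p \<in> extensional closed_rhp"
  unfolding exp_polys_def exp_poly_def by auto

lemma exp_polys_bounded:
  assumes "p \<in> exp_polys"
  obtains B where "\<And>s. 0 \<le> Re s \<Longrightarrow> cmod (p s) \<le> B"
proof -
  obtain K c where K: "finite K" "K \<subseteq> {0..}" and p: "p = exp_poly K c"
    using assms unfolding exp_polys_def by blast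
  have "cmod (p s) \<le> (\<Sum>t\<in>K. cmod (c t))" if "0 \<le> Re s" for s
    unfolding p exp_poly_apply [OF that]
  proof (rule sum_norm_le)
    fix t assume "t \<in> K"
    then show "cmod (c t * exp (- (s * of_real t))) \<le> cmod (c t)"
      using norm_exp_monomial_le [OF that, of t] K
      by (auto simp: norm_mult intro!: mult_left_le)
  qed
  then show ?thesis
    using that by blast
qed

lemma exp_polys_zero: "(\<lambda>s\<in>closed_rhp. 0) \<in> exp_polys"
proof -
  have "exp_poly {} (\<lambda>_. 0) = (\<lambda>s\<in>closed_rhp. 0)"
    unfolding exp_poly_def by (rule restrict_ext) simp
  then show ?thesis
    using exp_polysI [of "{}" "\<lambda>_. 0"] by (simp only: finite.emptyI empty_subsetI)
qed

lemma exp_polys_monomial: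
  assumes "0 \<le> t" shows "(\<lambda>s\<in>closed_rhp. c * exp (- (s * of_real t))) \<in> exp_polys"
  using exp_polysI [of "{t}" "\<lambda>_. c"] assms by (simp add: exp_poly_def)

lemma exp_polys_add:
  assumes "p \<in> exp_polys" "q \<in> exp_polys"
  shows "(\<lambda>s\<in>closed_rhp. p s + q s) \<in> exp_polys"
proof -
  obtain K c L d where K: "finite K" "K \<subseteq> {0..}" "finite L" "L \<subseteq> {0..}"
    and p: "p = exp_poly K c" and q: "q = exp_poly L d"
    using assms unfolding exp_polys_def by blast
  define b where "b = (\<lambda>t. (if t \<in> K then c t else 0) + (if t \<in> L then d t else 0))"
  have "p s + q s = exp_poly (K \<union> L) b s" if "0 \<le> Re s" for s
  proof -
    have "p s = (\<Sum>t\<in>K \<union> L. (if t \<in> K then c t else 0) * exp (- (s * of_real t)))"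
      unfolding p exp_poly_apply [OF that] using K
      by (intro sum.mono_neutral_cong_left) auto
    moreover have "q s = (\<Sum>t\<in>K \<union> L. (if t \<in> L then d t else 0) * exp (- (s * of_real t)))"
      unfolding q exp_poly_apply [OF that] using K
      by (intro sum.mono_neutral_cong_left) auto
    ultimately show ?thesis
      unfolding exp_poly_apply [OF that] b_def
      by (simp add: sum.distrib [symmetric] distrib_right)
  qed
  then have "(\<lambda>s\<in>closed_rhp. p s + q s) = exp_poly (K \<union> L) b"
    by (intro extensionalityI [of _ closed_rhp]) (auto simp: exp_poly_def)
  then show ?thesis
    using exp_polysI [of "K \<union> L" b] K by simp
qed

lemma exp_polys_sum:
  assumes "finite I" "\<And>i. i \<in> I \<Longrightarrow> (\<lambda>s\<in>closed_rhp. p i s) \<in> exp_polys"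
  shows "(\<lambda>s\<in>closed_rhp. \<Sum>i\<in>I. p i s) \<in> exp_polys"
  using assms
proof (induction I rule: finite_induct)
  case empty
  show ?case using exp_polys_zero by (simp only: sum.empty)
next
  case (insert i I)
  then have "(\<lambda>s\<in>closed_rhp. (\<lambda>s\<in>closed_rhp. p i s) s + (\<lambda>s\<in>closed_rhp. \<Sum>i\<in>I. p i s) s) \<in> exp_polys"
    by (intro exp_polys_add) auto
  then show ?case
    by (rule back_subst [where P = "\<lambda>u. u \<in> exp_polys"]) (rule restrict_ext, simp add: insert.hyps)
qed

lemma exp_polys_mult:
  assumes "p \<in> exp_polys" "q \<in> exp_polys"
  shows "(\<lambda>s\<in>closed_rhp. p s * q s) \<in> exp_polys"
proof -
  obtain K c L d where K: "finite K" "K \<subseteq> {0..}" "finite L" "L \<subseteq> {0..}"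
    and p: "p = exp_poly K c" and q: "q = exp_poly L d"
    using assms unfolding exp_polys_def by blast
  have "(\<lambda>s\<in>closed_rhp. \<Sum>t\<in>K. \<Sum>u\<in>L. c t * d u * exp (- (s * of_real (t + u)))) \<in> exp_polys"
    using K by (intro exp_polys_sum exp_polys_monomial add_nonneg_nonneg) auto
  also have "(\<lambda>s\<in>closed_rhp. \<Sum>t\<in>K. \<Sum>u\<in>L. c t * d u * exp (- (s * of_real (t + u))))
      = (\<lambda>s\<in>closed_rhp. p s * q s)"
    by (rule restrict_ext)
      (simp add: p q exp_poly_apply sum_product exp_add [symmetric] algebra_simps)
  finally show ?thesis .
qed

lemma mspace_rhp_iff:
  "h \<in> mspace (funspace closed_rhp euclidean_metric) \<longleftrightarrow>
     h \<in> extensional closed_rhp \<and> (\<exists>B. \<forall>s. 0 \<le> Re s \<longrightarrow> cmod (h s) \<le> B)"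
  proof -
  have "h \<in> mspace (funspace closed_rhp euclidean_metric) \<longleftrightarrow>
      h \<in> extensional closed_rhp \<and> bounded (h ` closed_rhp)"
    by (simp add: Met_TC.fspace_def)
  also have "bounded (h ` closed_rhp) \<longleftrightarrow> (\<exists>B. \<forall>s. 0 \<le> Re s \<longrightarrow> cmod (h s) \<le> B)"
    unfolding bounded_iff by (simp add: closed_rhp_def)
  finally show ?thesis .
qed

lemma mdist_rhp_le:
  assumes "\<And>s. 0 \<le> Re s \<Longrightarrow> cmod (h s - k s) \<le> e" "0 \<le> e"
  shows "mdist (funspace closed_rhp euclidean_metric) h k \<le> e"
  using assms closed_rhp_nonempty
  by (auto simp: Met_TC.fdist_def dist_norm intro!: cSUP_least)

lemma norm_diff_le_mdist_rhp:
  assumes "h \<in> mspace (funspace closed_rhp euclidean_metric)"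
    "k \<in> mspace (funspace closed_rhp euclidean_metric)" "0 \<le> Re s"
  shows "cmod (h s - k s) \<le> mdist (funspace closed_rhp euclidean_metric) h k"
proof -
  have "bdd_above ((\<lambda>u. dist (h u) (k u)) ` closed_rhp)"
    using assms closed_rhp_nonempty by (intro Met_TC.bdd_above_dist) auto
  then show ?thesis
    using assms closed_rhp_nonempty
    by (auto simp: Met_TC.fdist_def dist_norm intro!: cSUP_upper)
qed

text \<open>
  A function within distance 1 of an exponential polynomial is bounded, so approximability alone
  places \<open>h\<close> in the metric space of bounded functions.
\<close>

lemma AP_plus_iff:
  "h \<in> AP_plus \<longleftrightarrow> h \<in> extensional closed_rhp \<and>
     (\<forall>e>0. \<exists>p\<in>exp_polys. \<forall>s. 0 \<le> Re s \<longrightarrow> cmod (h s - p s) \<le> e)" (is "_ \<longleftrightarrow> ?R")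
proof -
  let ?M = "funspace closed_rhp (euclidean_metric :: complex metric)"
  interpret F: Metric_space "mspace ?M" "mdist ?M"
    by (rule Metric_space_mspace_mdist)
  have pM: "p \<in> mspace ?M" if "p \<in> exp_polys" for p
    unfolding mspace_rhp_iff
    using exp_polys_extensional [OF that] by (auto intro: exp_polys_bounded [OF that])
  have eq: "h \<in> AP_plus \<longleftrightarrow>
      h \<in> mspace ?M \<and> (\<forall>e>0. \<exists>p\<in>exp_polys. mdist ?M h p \<le> e)"
    unfolding AP_plus_def sup_norm_topology_def mtopology_of_def F.metric_closure_of_alt
    using pM by (auto simp del: mspace_funspace mdist_funspace)
  show ?thesis
  proof
    assume "h \<in> AP_plus"
    then have h: "h \<in> mspace ?M" and app: "\<And>e. e > 0 \<Longrightarrow> \<exists>p\<in>exp_polys. mdist ?M h p \<le> e"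
      using eq by blast+
    have "\<exists>p\<in>exp_polys. \<forall>s. 0 \<le> Re s \<longrightarrow> cmod (h s - p s) \<le> e" if "e > 0" for e
      proof -
      obtain p where p: "p \<in> exp_polys" and "mdist ?M h p \<le> e"
        using app [OF \<open>e > 0\<close>] by blast
      then show ?thesis
        using norm_diff_le_mdist_rhp [OF h pM [OF p]]
        by (intro bexI [OF _ p] allI impI) (rule order_trans)
    qed
    then show ?R
      using h unfolding mspace_rhp_iff by blast
  next
    assume R: ?R
    then obtain p where p: "p \<in> exp_polys" and hp: "\<forall>s. 0 \<le> Re s \<longrightarrow> cmod (h s - p s) \<le> 1"
      by (meson zero_less_one)
    obtain B where "\<And>s. 0 \<le> Re s \<Longrightarrow> cmod (p s) \<le> B"
      using exp_polys_bounded [OF p] by blast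
    then have "cmod (h s) \<le> 1 + B" if "0 \<le> Re s" for s
      using hp that norm_triangle_ineq [of "h s - p s" "p s"] by fastforce
    then have "h \<in> mspace ?M"
      unfolding mspace_rhp_iff using R by blast
    then show "h \<in> AP_plus"
      unfolding eq using R
      by (auto simp del: mspace_funspace mdist_funspace) (metis less_imp_le mdist_rhp_le)
  qed
qed

lemma AP_plus_extensional: "h \<in> AP_plus \<Longrightarrow> h \<in> extensional closed_rhp"
  by (simp add: AP_plus_iff)

lemma AP_plus_approx:
  assumes "h \<in> AP_plus" "e > 0"
  obtains p where "p \<in> exp_polys" "\<And>s. 0 \<le> Re s \<Longrightarrow> cmod (h s - p s) \<le> e"
  using assms unfolding AP_plus_iff by metis

lemma exp_polys_subset_AP_plus: "p \<in> exp_polys \<Longrightarrow> p \<in> AP_plus"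
  unfolding AP_plus_iff
  by (intro conjI allI impI exp_polys_extensional bexI [where x = p]) auto

lemma AP_plus_bounded:
  assumes "h \<in> AP_plus"
  obtains B where "\<And>s. 0 \<le> Re s \<Longrightarrow> cmod (h s) \<le> B"
proof -
  obtain p where p: "p \<in> exp_polys" and hp: "\<And>s. 0 \<le> Re s \<Longrightarrow> cmod (h s - p s) \<le> 1"
    using AP_plus_approx [OF assms zero_less_one] by blast
  obtain B where B: "\<And>s. 0 \<le> Re s \<Longrightarrow> cmod (p s) \<le> B"
    using exp_polys_bounded [OF p] by blast
  have "cmod (h s) \<le> 1 + B" if "0 \<le> Re s" for s
    using hp [OF that] B [OF that] norm_triangle_ineq [of "h s - p s" "p s"] by fastforce
  then show ?thesis
    using that by blast
qed

lemma AP_plus_uniform_closure: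
  assumes "h \<in> extensional closed_rhp"
    and app: "\<And>e. e > 0 \<Longrightarrow> \<exists>k\<in>AP_plus. \<forall>s. 0 \<le> Re s \<longrightarrow> cmod (h s - k s) \<le> e"
  shows "h \<in> AP_plus"
  unfolding AP_plus_iff
proof (intro conjI allI impI assms(1))
  fix e :: real assume "e > 0"
  then have e2: "e / 2 > 0" by simp
  obtain k where k: "k \<in> AP_plus" "\<And>s. 0 \<le> Re s \<Longrightarrow> cmod (h s - k s) \<le> e / 2"
    using app [OF e2] by blast
  obtain p where p: "p \<in> exp_polys" "\<And>s. 0 \<le> Re s \<Longrightarrow> cmod (k s - p s) \<le> e / 2"
    using AP_plus_approx [OF k(1) e2] by blast
  have "cmod (h s - p s) \<le> e" if "0 \<le> Re s" for s
    using k(2) [OF that] p(2) [OF that] norm_triangle_ineq [of "h s - k s" "k s - p s"] by simp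
  then show "\<exists>p\<in>exp_polys. \<forall>s. 0 \<le> Re s \<longrightarrow> cmod (h s - p s) \<le> e"
    using p(1) by blast
qed

lemma AP_plus_const: "(\<lambda>s\<in>closed_rhp. c) \<in> AP_plus"
  using exp_polys_monomial [of 0 c] by (intro exp_polys_subset_AP_plus) simp

lemma AP_plus_add:
  assumes "h \<in> AP_plus" "k \<in> AP_plus"
  shows "(\<lambda>s\<in>closed_rhp. h s + k s) \<in> AP_plus"
  unfolding AP_plus_iff
proof (intro conjI allI impI)
  fix e :: real assume "e > 0"
  then have e2: "e / 2 > 0" by simp
  obtain p where p: "p \<in> exp_polys" "\<And>s. 0 \<le> Re s \<Longrightarrow> cmod (h s - p s) \<le> e / 2"
    using AP_plus_approx [OF assms(1) e2] by blast
  obtain q where q: "q \<in> exp_polys" "\<And>s. 0 \<le> Re s \<Longrightarrow> cmod (k s - q s) \<le> e / 2"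
    using AP_plus_approx [OF assms(2) e2] by blast
  have "cmod (h s + k s - (p s + q s)) \<le> e" if "0 \<le> Re s" for s
    using p(2) [OF that] q(2) [OF that] norm_triangle_ineq [of "h s - p s" "k s - q s"]
    by (simp add: algebra_simps)
  then show "\<exists>r\<in>exp_polys. \<forall>s. 0 \<le> Re s \<longrightarrow> cmod ((\<lambda>s\<in>closed_rhp. h s + k s) s - r s) \<le> e"
    by (intro bexI [OF _ exp_polys_add [OF p(1) q(1)]]) simp
qed auto

lemma AP_plus_mult:
  assumes "h \<in> AP_plus" "k \<in> AP_plus"
  shows "(\<lambda>s\<in>closed_rhp. h s * k s) \<in> AP_plus"
  unfolding AP_plus_iff
proof (intro conjI allI impI)
  fix e :: real assume "e > 0"
  obtain B where B: "\<And>s. 0 \<le> Re s \<Longrightarrow> cmod (h s) \<le> B"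
    using AP_plus_bounded [OF assms(1)] by blast
  have B0: "0 \<le> B" using B [of 0] by (simp add: order_trans [OF norm_ge_zero])
  \<comment> \<open>First approximate \<open>k\<close> so well that multiplying by \<open>h\<close> costs at most \<open>e/2\<close>; only then is the
    bound of the approximant, which governs the accuracy needed for \<open>h\<close>, available.\<close>
  have e1: "e / (2 * (B + 1)) > 0" using \<open>e > 0\<close> B0 by simp
  obtain q where q: "q \<in> exp_polys" "\<And>s. 0 \<le> Re s \<Longrightarrow> cmod (k s - q s) \<le> e / (2 * (B + 1))"
    using AP_plus_approx [OF assms(2) e1] by blast
  obtain C where C: "\<And>s. 0 \<le> Re s \<Longrightarrow> cmod (q s) \<le> C"
    using exp_polys_bounded [OF q(1)] by blast
  have C0: "0 \<le> C" using C [of 0] by (simp add: order_trans [OF norm_ge_zero])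
  have e2: "e / (2 * (C + 1)) > 0" using \<open>e > 0\<close> C0 by simp
  obtain p where p: "p \<in> exp_polys" "\<And>s. 0 \<le> Re s \<Longrightarrow> cmod (h s - p s) \<le> e / (2 * (C + 1))"
    using AP_plus_approx [OF assms(1) e2] by blast
  have "cmod (h s * k s - p s * q s) \<le> e" if s: "0 \<le> Re s" for s
  proof -
    have "cmod (h s * k s - p s * q s) \<le> cmod (h s * (k s - q s)) + cmod ((h s - p s) * q s)"
      using norm_triangle_ineq [of "h s * (k s - q s)" "(h s - p s) * q s"]
      by (simp add: algebra_simps)
    also have "\<dots> \<le> B * (e / (2 * (B + 1))) + e / (2 * (C + 1)) * C"
      unfolding norm_mult using B [OF s] C [OF s] p(2) [OF s] q(2) [OF s] B0 e2
      by (intro add_mono mult_mono) auto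
    also have "\<dots> \<le> e / 2 + e / 2"
      using \<open>e > 0\<close> B0 C0 by (intro add_mono) (auto simp: field_simps)
    finally show ?thesis by simp
  qed
  then show "\<exists>r\<in>exp_polys. \<forall>s. 0 \<le> Re s \<longrightarrow> cmod ((\<lambda>s\<in>closed_rhp. h s * k s) s - r s) \<le> e"
    by (intro bexI [OF _ exp_polys_mult [OF p(1) q(1)]]) simp
qed auto

text \<open>
  The partial sums of the Neumann series are in the algebra and converge uniformly on the half plane.
\<close>

lemma AP_plus_resolvent:
  assumes h: "h \<in> AP_plus" and B: "\<And>s. 0 \<le> Re s \<Longrightarrow> cmod (h s) \<le> B" and l: "B < cmod l"
  shows "(\<lambda>s\<in>closed_rhp. 1 / (l - h s)) \<in> AP_plus"
proof (rule AP_plus_uniform_closure)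
  have B0: "0 \<le> B" using B [of 0] by (simp add: order_trans [OF norm_ge_zero])
  with l have l0: "l \<noteq> 0" by auto
  have part: "(\<lambda>s\<in>closed_rhp. \<Sum>n<N. (h s / l) ^ n / l) \<in> AP_plus" for N
  proof -
    have pow: "(\<lambda>s\<in>closed_rhp. (h s / l) ^ n / l) \<in> AP_plus" for n
    proof (induction n)
      case 0
      show ?case using AP_plus_const [of "1 / l"] by (simp del: restrict_apply)
    next
      case (Suc n)
      from AP_plus_mult [OF AP_plus_mult [OF h AP_plus_const [of "1 / l"]] Suc]
      show ?case by (rule back_subst [where P = "\<lambda>u. u \<in> AP_plus"]) (rule restrict_ext, simp)
    qed
    show ?thesis
    proof (induction N)
      case 0
      show ?case using AP_plus_const [of 0] by (simp del: restrict_apply)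
    next
      case (Suc N)
      from AP_plus_add [OF Suc pow [of N]] show ?case
        by (rule back_subst [where P = "\<lambda>u. u \<in> AP_plus"]) (rule restrict_ext, simp)
    qed
  qed
  fix e :: real assume "e > 0"
  have "(\<lambda>N. (B / cmod l) ^ N / (cmod l - B)) \<longlonglongrightarrow> 0 / (cmod l - B)"
    using B0 l by (intro tendsto_divide LIMSEQ_power_zero) (auto simp: divide_simps)
  then obtain N where N: "(B / cmod l) ^ N / (cmod l - B) < e"
    using \<open>e > 0\<close> order_tendstoD(2) [of _ 0 sequentially e] eventually_sequentially by fastforce
  have "cmod (1 / (l - h s) - (\<Sum>n<N. (h s / l) ^ n / l)) \<le> e" if s: "0 \<le> Re s" for s
  proof -
    have gap: "cmod l - B \<le> cmod (l - h s)"
      using B [OF s] norm_triangle_ineq2 [of l "h s"] by linarith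
    with l have ne: "l - h s \<noteq> 0" by auto
    then have "h s / l \<noteq> 1" using l0 by (simp add: divide_simps)
    then have "(\<Sum>n<N. (h s / l) ^ n / l) = (1 - (h s / l) ^ N) / ((1 - h s / l) * l)"
      by (simp only: sum_gp_strict sum_divide_distrib [symmetric] divide_divide_eq_left if_False)
    also have "(1 - h s / l) * l = l - h s"
      using l0 by (simp add: left_diff_distrib)
    finally have "(\<Sum>n<N. (h s / l) ^ n / l) = (1 - (h s / l) ^ N) / (l - h s)" .
    then have "1 / (l - h s) - (\<Sum>n<N. (h s / l) ^ n / l) = (h s / l) ^ N / (l - h s)"
      by (simp add: diff_divide_distrib)
    also have "cmod \<dots> \<le> (B / cmod l) ^ N / (cmod l - B)"
      unfolding norm_divide norm_power using B [OF s] gap l B0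
      by (intro frac_le power_mono divide_right_mono) auto
    finally show ?thesis using N by simp
  qed
  then show "\<exists>k\<in>AP_plus. \<forall>s. 0 \<le> Re s \<longrightarrow>
      cmod ((\<lambda>s\<in>closed_rhp. 1 / (l - h s)) s - k s) \<le> e"
    by (intro bexI [OF _ part [of N]]) simp
qed auto

lemma AP_plus_uniform_limit:
  assumes "h \<in> AP_plus"
  obtains p where "\<And>n. p n \<in> exp_polys" "uniform_limit closed_rhp p h sequentially"
proof -
  have "\<exists>p. p \<in> exp_polys \<and> (\<forall>s. 0 \<le> Re s \<longrightarrow> cmod (h s - p s) \<le> inverse (real (Suc n)))" for n
    by (rule AP_plus_approx [OF assms, of "inverse (real (Suc n))"]) auto
  then have "\<exists>p. \<forall>n. p n \<in> exp_polys \<and>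
      (\<forall>s. 0 \<le> Re s \<longrightarrow> cmod (h s - p n s) \<le> inverse (real (Suc n)))"
    by (rule choice [OF allI])
  then obtain p where p: "\<And>n. p n \<in> exp_polys"
    and hp: "\<And>n s. 0 \<le> Re s \<Longrightarrow> cmod (h s - p n s) \<le> inverse (real (Suc n))"
    by blast
  have "uniform_limit closed_rhp p h sequentially"
    unfolding uniform_limit_iff
  proof (intro allI impI)
    fix e :: real assume "e > 0"
    then have "\<forall>\<^sub>F n in sequentially. inverse (real (Suc n)) < e"
      by (rule order_tendstoD(2) [OF LIMSEQ_inverse_real_of_nat])
    then show "\<forall>\<^sub>F n in sequentially. \<forall>s\<in>closed_rhp. dist (p n s) (h s) < e"
    proof eventually_elim
      case (elim n)
      show ?case
      proof
        fix s assume "s \<in> closed_rhp"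
        then show "dist (p n s) (h s) < e"
          using hp [of s n] elim by (simp add: dist_norm norm_minus_commute)
      qed
    qed
  qed
  with p show ?thesis
    by (rule that)
qed

lemma exp_polys_holomorphic:
  assumes "p \<in> exp_polys" shows "p holomorphic_on open_rhp"
proof -
  obtain K c where "p = exp_poly K c"
    using assms unfolding exp_polys_def by blast
  moreover have "(\<lambda>s. \<Sum>t\<in>K. c t * exp (- (s * of_real t))) holomorphic_on open_rhp"
    by (intro holomorphic_intros)
  ultimately show ?thesis
    by (metis (no_types, lifting) exp_poly_apply holomorphic_transform less_imp_le open_rhp_iff)
qed

lemma exp_polys_continuous:
  assumes "p \<in> exp_polys" shows "continuous_on closed_rhp p"
proof -
  obtain K c where "p = exp_poly K c"
    using assms unfolding exp_polys_def by blast
  moreover have "continuous_on closed_rhp (\<lambda>s. \<Sum>t\<in>K. c t * exp (- (s * of_real t)))"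
    by (intro continuous_intros)
  ultimately show ?thesis
    by (subst continuous_on_cong [OF refl, where g = "\<lambda>s. \<Sum>t\<in>K. c t * exp (- (s * of_real t))"])
      (simp_all add: exp_poly_apply)
qed

lemma AP_plus_continuous:
  assumes "h \<in> AP_plus" shows "continuous_on closed_rhp h"
  proof -
  obtain p where p: "\<And>n. p n \<in> exp_polys" and lim: "uniform_limit closed_rhp p h sequentially"
    using AP_plus_uniform_limit [OF assms] by blast
  show ?thesis
    by (rule uniform_limit_theorem [OF _ lim]) (simp_all add: exp_polys_continuous p)
qed

lemma AP_plus_holomorphic:
  assumes "h \<in> AP_plus" shows "h holomorphic_on open_rhp"
proof -
  obtain p where p: "\<And>n. p n \<in> exp_polys" and lim: "uniform_limit closed_rhp p h sequentially"
    using AP_plus_uniform_limit [OF assms] by blast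
  show ?thesis
  proof (rule holomorphic_uniform_sequence [OF open_open_rhp])
    show "p n holomorphic_on open_rhp" for n
      using p exp_polys_holomorphic by blast
    fix x assume "x \<in> open_rhp"
    then obtain d where d: "d > 0" "cball x d \<subseteq> open_rhp"
      using open_open_rhp open_contains_cball by blast
    moreover have "open_rhp \<subseteq> closed_rhp"
      unfolding open_rhp_def closed_rhp_def by auto
    ultimately show "\<exists>d>0. cball x d \<subseteq> open_rhp \<and> uniform_limit (cball x d) p h sequentially"
      using uniform_limit_on_subset [OF lim, of "cball x d"] by (meson order_trans)
  qed
qed

section \<open>Holomorphic functions vanishing at infinity\<close>

lemma A0_iff:
  "f \<in> A0 \<longleftrightarrow> f \<in> extensional closed_rhp \<and> f holomorphic_on open_rhp \<and>
     continuous_on closed_rhp f \<and>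
     (\<forall>e>0. \<exists>R. \<forall>s. R \<le> cmod s \<longrightarrow> 0 \<le> Re s \<longrightarrow> cmod (f s) < e)"
  unfolding A0_def tendsto_iff eventually_inf_principal eventually_at_infinity
  by simp

lemma A0_extensional: "f \<in> A0 \<Longrightarrow> f \<in> extensional closed_rhp"
  by (simp add: A0_iff)

lemma A0_holomorphic: "f \<in> A0 \<Longrightarrow> f holomorphic_on open_rhp"
  by (simp add: A0_iff)

lemma A0_continuous: "f \<in> A0 \<Longrightarrow> continuous_on closed_rhp f"
  by (simp add: A0_iff)

lemma A0_small_at_infinity:
  assumes "f \<in> A0" "e > 0"
  obtains R where "R > 0" "\<And>s. \<lbrakk>0 \<le> Re s; R \<le> cmod s\<rbrakk> \<Longrightarrow> cmod (f s) < e"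
proof -
  obtain R where R: "\<forall>s. R \<le> cmod s \<longrightarrow> 0 \<le> Re s \<longrightarrow> cmod (f s) < e"
    using assms unfolding A0_iff by blast
  show ?thesis
    by (rule that [of "max R 1"]) (use R in auto)
qed

lemma A0_bounded:
  assumes "f \<in> A0"
  obtains B where "\<And>s. 0 \<le> Re s \<Longrightarrow> cmod (f s) \<le> B"
proof -
  obtain R where R: "\<And>s. \<lbrakk>0 \<le> Re s; R \<le> cmod s\<rbrakk> \<Longrightarrow> cmod (f s) < 1"
    using A0_small_at_infinity [OF assms zero_less_one] by blast
  have "closed closed_rhp"
    unfolding closed_rhp_def by (rule closed_halfspace_Re_ge)
  then have "compact (closed_rhp \<inter> cball 0 R)"
    by (intro closed_Int_compact) auto
  moreover have "continuous_on (closed_rhp \<inter> cball 0 R) f"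
    using A0_continuous [OF assms] by (rule continuous_on_subset) simp
  ultimately have "bounded (f ` (closed_rhp \<inter> cball 0 R))"
    by (intro compact_imp_bounded compact_continuous_image)
  then obtain C where C: "\<forall>x\<in>closed_rhp \<inter> cball 0 R. cmod (f x) \<le> C"
    unfolding bounded_iff by blast
  have "cmod (f s) \<le> max C 1" if "0 \<le> Re s" for s
  proof (cases "R \<le> cmod s")
    case True
    then show ?thesis using R [OF that] by fastforce
  next
    case False
    then have "s \<in> closed_rhp \<inter> cball 0 R" using that by simp
    then have "cmod (f s) \<le> C" using C by blast
    then show ?thesis by simp
  qed
  then show ?thesis using that by blast
qed

lemma restrict_holomorphic:
  "u holomorphic_on open_rhp \<Longrightarrow> restrict u closed_rhp holomorphic_on open_rhp"
  by (erule holomorphic_transform) simp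

lemma restrict_continuous:
  "continuous_on closed_rhp u \<Longrightarrow> continuous_on closed_rhp (restrict u closed_rhp)"
  by (subst continuous_on_cong [OF refl, where g = u]) simp_all

lemma A0_mult_bounded:
  assumes f: "f \<in> A0" and hol: "u holomorphic_on open_rhp" and cont: "continuous_on closed_rhp u"
    and B: "\<And>s. 0 \<le> Re s \<Longrightarrow> cmod (u s) \<le> B"
  shows "(\<lambda>s\<in>closed_rhp. f s * u s) \<in> A0"
  unfolding A0_iff
proof (intro conjI allI impI)
  show "(\<lambda>s\<in>closed_rhp. f s * u s) holomorphic_on open_rhp"
    by (intro restrict_holomorphic holomorphic_on_mult A0_holomorphic [OF f] hol)
  show "continuous_on closed_rhp (\<lambda>s\<in>closed_rhp. f s * u s)"
    by (intro restrict_continuous continuous_on_mult A0_continuous [OF f] cont)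
  fix e :: real assume "e > 0"
  have B0: "0 \<le> B" using B [of 0] by (simp add: order_trans [OF norm_ge_zero])
  have e1: "e / (B + 1) > 0" using \<open>e > 0\<close> B0 by simp
  obtain R where R: "\<And>s. \<lbrakk>0 \<le> Re s; R \<le> cmod s\<rbrakk> \<Longrightarrow> cmod (f s) < e / (B + 1)"
    using A0_small_at_infinity [OF f e1] by blast
  have "cmod (f s * u s) < e" if s: "0 \<le> Re s" "R \<le> cmod s" for s
  proof -
    have "cmod (f s * u s) \<le> cmod (f s) * B"
      unfolding norm_mult using B [OF s(1)] by (intro mult_left_mono) auto
    also have "\<dots> \<le> cmod (f s) * (B + 1)"
      by (intro mult_left_mono) auto
    also have "\<dots> < e"
      using R [OF s] B0 by (simp add: pos_less_divide_eq)
    finally show ?thesis .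
  qed
  then show "\<exists>R. \<forall>s. R \<le> cmod s \<longrightarrow> 0 \<le> Re s \<longrightarrow> cmod ((\<lambda>s\<in>closed_rhp. f s * u s) s) < e"
    by (intro exI [of _ R]) simp
qed simp

lemma A0_add:
  assumes "f \<in> A0" "g \<in> A0"
  shows "(\<lambda>s\<in>closed_rhp. f s + g s) \<in> A0"
  unfolding A0_iff
proof (intro conjI allI impI)
  show "(\<lambda>s\<in>closed_rhp. f s + g s) holomorphic_on open_rhp"
    using assms by (intro restrict_holomorphic holomorphic_on_add A0_holomorphic)
  show "continuous_on closed_rhp (\<lambda>s\<in>closed_rhp. f s + g s)"
    using assms by (intro restrict_continuous continuous_on_add A0_continuous)
  fix e :: real assume "e > 0"
  then have e2: "e / 2 > 0" by simp
  obtain R where R: "\<And>s. \<lbrakk>0 \<le> Re s; R \<le> cmod s\<rbrakk> \<Longrightarrow> cmod (f s) < e / 2"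
    using A0_small_at_infinity [OF assms(1) e2] by blast
  obtain Q where Q: "\<And>s. \<lbrakk>0 \<le> Re s; Q \<le> cmod s\<rbrakk> \<Longrightarrow> cmod (g s) < e / 2"
    using A0_small_at_infinity [OF assms(2) e2] by blast
  have "cmod (f s + g s) < e" if "0 \<le> Re s" "max R Q \<le> cmod s" for s
    proof -
    have "cmod (f s) < e / 2" "cmod (g s) < e / 2"
      using R Q that by simp_all
    then show ?thesis
      using norm_add_less [of "f s" "e / 2" "g s" "e / 2"] by simp
  qed
  then show "\<exists>R. \<forall>s. R \<le> cmod s \<longrightarrow> 0 \<le> Re s \<longrightarrow> cmod ((\<lambda>s\<in>closed_rhp. f s + g s) s) < e"
    by (intro exI [of _ "max R Q"]) simp
qed simp

lemma A0_cmult: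
  assumes "f \<in> A0" shows "(\<lambda>s\<in>closed_rhp. c * f s) \<in> A0"
  proof -
  have "(\<lambda>s\<in>closed_rhp. f s * c) \<in> A0"
    by (rule A0_mult_bounded [OF assms, of "\<lambda>_. c" "cmod c"]) simp_all
  then show ?thesis
    by (simp only: mult.commute)
qed

lemma A0_mult:
  assumes "f \<in> A0" "g \<in> A0" shows "(\<lambda>s\<in>closed_rhp. f s * g s) \<in> A0"
  proof -
  obtain B where "\<And>s. 0 \<le> Re s \<Longrightarrow> cmod (g s) \<le> B"
    using A0_bounded [OF assms(2)] by blast
  then show ?thesis
    using assms(2) by (intro A0_mult_bounded [OF assms(1)] A0_holomorphic A0_continuous)
qed

text \<open>
  The resolvents of the unbounded coordinate function \<open>s\<close>; for \<open>Re w < 0\<close> they are in \<open>A0\<close>.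
\<close>

definition recip :: "complex \<Rightarrow> complex \<Rightarrow> complex" where
  "recip w = (\<lambda>s\<in>closed_rhp. 1 / (s - w))"

lemma recip_apply [simp]: "0 \<le> Re s \<Longrightarrow> recip w s = 1 / (s - w)"
  by (simp add: recip_def)

lemma recip_extensional [simp]: "recip w \<in> extensional closed_rhp"
  by (simp add: recip_def)

lemma A0_recip:
  assumes "Re w < 0" shows "recip w \<in> A0"
  unfolding A0_iff recip_def
proof (intro conjI allI impI)
  have ne: "s - w \<noteq> 0" if "0 \<le> Re s" for s
    using assms that by auto
  show "(\<lambda>s\<in>closed_rhp. 1 / (s - w)) holomorphic_on open_rhp"
    by (intro restrict_holomorphic holomorphic_intros ne) simp
  show "continuous_on closed_rhp (\<lambda>s\<in>closed_rhp. 1 / (s - w))"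
    by (intro restrict_continuous continuous_intros ballI ne) simp
  fix e :: real assume "e > 0"
  have "cmod (1 / (s - w)) < e" if s: "0 \<le> Re s" "cmod w + 2 / e \<le> cmod s" for s
  proof -
    have "2 / e \<le> cmod (s - w)"
      using s(2) norm_triangle_ineq2 [of s w] by linarith
    moreover have "1 / e < 2 / e" using \<open>e > 0\<close> by (simp add: divide_strict_right_mono)
    ultimately have "1 / e < cmod (s - w)" by linarith
    then show ?thesis
      using \<open>e > 0\<close> ne [OF s(1)] by (simp add: norm_divide field_simps)
  qed
  then show "\<exists>R. \<forall>s. R \<le> cmod s \<longrightarrow> 0 \<le> Re s \<longrightarrow> cmod ((\<lambda>s\<in>closed_rhp. 1 / (s - w)) s) < e"
    by (intro exI [of _ "cmod w + 2 / e"]) simp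
qed simp

text \<open>
  The singularity at the interior point \<open>a\<close> is removable, continuity is at stake only away from
  \<open>a\<close>, and dividing by \<open>s - a\<close> does not enlarge the modulus once \<open>\<bar>s\<bar> \<ge> \<bar>a\<bar> + 1\<close>.
\<close>

lemma A0_divide_root:
  assumes f: "f \<in> A0" and a: "0 < Re a" "f a = 0"
  shows "(\<lambda>s\<in>closed_rhp. if s = a then deriv f a else f s / (s - a)) \<in> A0"
    (is "restrict ?q _ \<in> _")
  unfolding A0_iff
proof (intro conjI allI impI)
  have "(\<lambda>s. if s = a then deriv f a else (f s - f a) / (s - a)) holomorphic_on open_rhp"
    by (intro pole_lemma_open open_open_rhp A0_holomorphic f)
  then have hol: "?q holomorphic_on open_rhp"
    unfolding a(2) diff_zero .
  then show "restrict ?q closed_rhp holomorphic_on open_rhp"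
    by (rule restrict_holomorphic)
  have "continuous (at s within closed_rhp) ?q" if s: "s \<in> closed_rhp" for s
  proof (cases "s = a")
    case True
    have "isCont ?q a"
      using holomorphic_on_imp_continuous_on [OF hol] a
      unfolding continuous_on_eq_continuous_at [OF open_open_rhp] by simp
    with True show ?thesis
      using continuous_at_imp_continuous_within by blast
  next
    case False
    have "continuous (at s within closed_rhp) f"
      using A0_continuous [OF f] s unfolding continuous_on_eq_continuous_within by blast
    then have "continuous (at s within closed_rhp) (\<lambda>s. f s / (s - a))"
      using False by (intro continuous_intros) auto
    then show ?thesis
      by (rule continuous_transform_within [where \<delta> = "dist s a"]) (use False s in \<open>auto simp: dist_commute\<close>)
  qed
  then show "continuous_on closed_rhp (restrict ?q closed_rhp)"
    by (intro restrict_continuous) (simp add: continuous_on_eq_continuous_within)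
  fix e :: real assume "e > 0"
  then obtain R where R: "\<And>s. \<lbrakk>0 \<le> Re s; R \<le> cmod s\<rbrakk> \<Longrightarrow> cmod (f s) < e"
    using A0_small_at_infinity [OF f] by blast
  have "cmod (?q s) < e" if s: "0 \<le> Re s" "max R (cmod a + 1) \<le> cmod s" for s
  proof -
    have "1 \<le> cmod (s - a)"
      using s(2) norm_triangle_ineq2 [of s a] by simp
    then have "cmod (f s / (s - a)) \<le> cmod (f s)"
      unfolding norm_divide by (simp add: divide_le_eq mult_left_le_one_le mult_le_cancel_left1)
    moreover have "cmod (f s) < e" using R s by simp
    moreover have "s \<noteq> a" using s(2) by auto
    ultimately show ?thesis by simp
  qed
  then show "\<exists>R. \<forall>s. R \<le> cmod s \<longrightarrow> 0 \<le> Re s \<longrightarrow> cmod (restrict ?q closed_rhp s) < e"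
    by (intro exI [of _ "max R (cmod a + 1)"]) simp
qed simp

section \<open>The sum algebra\<close>

lemma A0_zero: "(\<lambda>s\<in>closed_rhp. 0) \<in> A0"
  using A0_cmult [OF A0_recip [of "-1"], of 0]
  by (rule back_subst [where P = "\<lambda>f. f \<in> A0"]) (simp_all only: mult_zero_left, simp)

lemma A0_AP_plusI:
  "\<lbrakk>g \<in> A0; h \<in> AP_plus\<rbrakk> \<Longrightarrow> (\<lambda>s\<in>closed_rhp. g s + h s) \<in> A0_AP_plus"
  unfolding A0_AP_plus_def by blast

lemma A0_AP_plusE:
  assumes "f \<in> A0_AP_plus"
  obtains g h where "g \<in> A0" "h \<in> AP_plus" "f = (\<lambda>s\<in>closed_rhp. g s + h s)"
  using assms unfolding A0_AP_plus_def by blast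

lemma A0_AP_plus_extensional: "f \<in> A0_AP_plus \<Longrightarrow> f \<in> extensional closed_rhp"
  by (auto elim: A0_AP_plusE)

lemma A0_subset:
  assumes "g \<in> A0" shows "g \<in> A0_AP_plus"
proof -
  have "(\<lambda>s\<in>closed_rhp. g s + (\<lambda>s\<in>closed_rhp. 0) s) = g"
    using A0_extensional [OF assms] by (intro extensionalityI [of _ closed_rhp]) auto
  then show ?thesis
    using A0_AP_plusI [OF assms AP_plus_const [of 0]] by (simp only:)
qed

lemma AP_plus_subset:
  assumes "h \<in> AP_plus" shows "h \<in> A0_AP_plus"
proof -
  have "(\<lambda>s\<in>closed_rhp. (\<lambda>s\<in>closed_rhp. 0) s + h s) = h"
    using AP_plus_extensional [OF assms] by (intro extensionalityI [of _ closed_rhp]) auto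
  then show ?thesis
    using A0_AP_plusI [OF A0_zero assms] by (simp only:)
qed

lemma AP_plus_cmult:
  assumes "h \<in> AP_plus" shows "(\<lambda>s\<in>closed_rhp. c * h s) \<in> AP_plus"
  using AP_plus_mult [OF AP_plus_const assms, of c]
  by (rule back_subst [where P = "\<lambda>f. f \<in> AP_plus"]) (rule restrict_ext, simp)

lemma A0_AP_plus_cmult:
  assumes "f \<in> A0_AP_plus" shows "(\<lambda>s\<in>closed_rhp. c * f s) \<in> A0_AP_plus"
proof -
  obtain g h where g: "g \<in> A0" and h: "h \<in> AP_plus" and f: "f = (\<lambda>s\<in>closed_rhp. g s + h s)"
    using assms by (rule A0_AP_plusE)
  have "(\<lambda>s\<in>closed_rhp. c * f s) =
      (\<lambda>s\<in>closed_rhp. (\<lambda>s\<in>closed_rhp. c * g s) s + (\<lambda>s\<in>closed_rhp. c * h s) s)"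
    unfolding f by (rule restrict_ext) (simp add: distrib_left)
  then show ?thesis
    using A0_AP_plusI [OF A0_cmult [OF g] AP_plus_cmult [OF h], of c c] by simp
qed

text \<open>
  The ideal property: elements of the algebra are bounded, continuous, and holomorphic inside,
  hence multipliers of \<open>A0\<close>.
\<close>

lemma A0_mult_A0_AP_plus:
  assumes "f \<in> A0" "k \<in> A0_AP_plus"
  shows "(\<lambda>s\<in>closed_rhp. f s * k s) \<in> A0"
proof -
  obtain g h where g: "g \<in> A0" and h: "h \<in> AP_plus" and k: "k = (\<lambda>s\<in>closed_rhp. g s + h s)"
    using assms(2) by (rule A0_AP_plusE)
  obtain B where B: "\<And>s. 0 \<le> Re s \<Longrightarrow> cmod (g s) \<le> B"
    using A0_bounded [OF g] by blast
  obtain C where C: "\<And>s. 0 \<le> Re s \<Longrightarrow> cmod (h s) \<le> C"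
    using AP_plus_bounded [OF h] by blast
  show ?thesis
  proof (rule A0_mult_bounded [OF assms(1)])
    show "k holomorphic_on open_rhp"
      unfolding k using g h
      by (intro restrict_holomorphic holomorphic_on_add A0_holomorphic AP_plus_holomorphic)
    show "continuous_on closed_rhp k"
      unfolding k using g h
      by (intro restrict_continuous continuous_on_add A0_continuous AP_plus_continuous)
    show "cmod (k s) \<le> B + C" if "0 \<le> Re s" for s
      unfolding k using B [OF that] C [OF that] that norm_triangle_mono by simp
  qed
qed

section \<open>Homomorphisms of the sum algebra\<close>

context
  fixes \<phi> :: "(complex \<Rightarrow> complex) \<Rightarrow> complex"
  assumes hom: "nonzero_hom closed_rhp A0_AP_plus \<phi>"
begin

lemma hom_mult:
  assumes "f \<in> A0_AP_plus" "g \<in> A0_AP_plus" "k \<in> extensional closed_rhp"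
    and "\<And>s. 0 \<le> Re s \<Longrightarrow> k s = f s * g s"
  shows "\<phi> k = \<phi> f * \<phi> g"
proof -
  have "k = (\<lambda>s\<in>closed_rhp. f s * g s)"
    using assms(3,4) by (intro extensionalityI [of _ closed_rhp]) auto
  then show ?thesis
    using hom assms(1,2) unfolding nonzero_hom_def by simp
qed

lemma hom_linear:
  assumes "f \<in> A0_AP_plus" "g \<in> A0_AP_plus" "k \<in> extensional closed_rhp"
    and "\<And>s. 0 \<le> Re s \<Longrightarrow> k s = f s + c * g s"
  shows "\<phi> k = \<phi> f + c * \<phi> g"
proof -
  let ?cg = "\<lambda>s\<in>closed_rhp. c * g s"
  have "k = (\<lambda>s\<in>closed_rhp. f s + ?cg s)"
    using assms(3,4) by (intro extensionalityI [of _ closed_rhp]) auto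
  moreover have "\<phi> (\<lambda>s\<in>closed_rhp. f s + ?cg s) = \<phi> f + \<phi> ?cg"
    using hom assms(1) A0_AP_plus_cmult [OF assms(2), of c] unfolding nonzero_hom_def by blast
  moreover have "\<phi> ?cg = c * \<phi> g"
    using hom assms(2) unfolding nonzero_hom_def by blast
  ultimately show ?thesis by simp
qed

lemma hom_cmult: "f \<in> A0_AP_plus \<Longrightarrow> \<phi> (\<lambda>s\<in>closed_rhp. c * f s) = c * \<phi> f"
  using hom unfolding nonzero_hom_def by blast

lemma hom_one: "\<phi> (\<lambda>s\<in>closed_rhp. 1) = 1"
proof -
  obtain f where f: "f \<in> A0_AP_plus" "\<phi> f \<noteq> 0"
    using hom unfolding nonzero_hom_def by blast
  have "\<phi> f = \<phi> f * \<phi> (\<lambda>s\<in>closed_rhp. 1)"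
    using f(1) AP_plus_subset [OF AP_plus_const] A0_AP_plus_extensional
    by (intro hom_mult) auto
  then show ?thesis using f(2) by simp
qed

text \<open>
  The hypothesis says \<open>q = f / (l - f)\<close>. This quasi-inverse replaces \<open>1 / (l - f)\<close> because it
  stays inside \<open>A0\<close>, which has no unit. If \<open>\<phi> f\<close> were \<open>l\<close>, applying \<open>\<phi>\<close> to
  \<open>l q = f + f q\<close> would give \<open>l = 0\<close>.
\<close>

lemma hom_avoids_quasi_inverse:
  assumes f: "f \<in> A0_AP_plus" and q: "q \<in> A0_AP_plus"
    and fq: "(\<lambda>s\<in>closed_rhp. f s * q s) \<in> A0_AP_plus"
    and eq: "\<And>s. 0 \<le> Re s \<Longrightarrow> l * q s = f s + f s * q s" and "l \<noteq> 0"
  shows "\<phi> f \<noteq> l"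
proof
  assume "\<phi> f = l"
  have "l * \<phi> q = \<phi> (\<lambda>s\<in>closed_rhp. l * q s)"
    by (rule hom_cmult [OF q, symmetric])
  also have "\<dots> = \<phi> f + 1 * \<phi> (\<lambda>s\<in>closed_rhp. f s * q s)"
    using f fq by (intro hom_linear) (auto simp: eq)
  also have "\<phi> (\<lambda>s\<in>closed_rhp. f s * q s) = \<phi> f * \<phi> q"
    using f q by (intro hom_mult) auto
  finally show False
    using \<open>\<phi> f = l\<close> \<open>l \<noteq> 0\<close> by simp
qed

lemma hom_contractive_AP_plus:
  assumes f: "f \<in> AP_plus" and B: "\<And>s. 0 \<le> Re s \<Longrightarrow> cmod (f s) \<le> B"
  shows "cmod (\<phi> f) \<le> B"
proof (rule ccontr)
  assume "\<not> cmod (\<phi> f) \<le> B"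
  then have l: "B < cmod (\<phi> f)" by simp
  have B0: "0 \<le> B" using B [of 0] by (simp add: order_trans [OF norm_ge_zero])
  define q where "q = (\<lambda>s\<in>closed_rhp. f s * (\<lambda>s\<in>closed_rhp. 1 / (\<phi> f - f s)) s)"
  have q: "q \<in> AP_plus"
    unfolding q_def by (rule AP_plus_mult [OF f AP_plus_resolvent [OF f B l]])
  have "\<phi> f * q s = f s + f s * q s" if s: "0 \<le> Re s" for s
  proof -
    have "\<phi> f \<noteq> f s" using B [OF s] l by auto
    then show ?thesis using s by (simp add: q_def divide_simps) (simp add: algebra_simps)
  qed
  then have "\<phi> f \<noteq> \<phi> f"
    using B0 l by (rule_tac hom_avoids_quasi_inverse [where q = q])
      (auto intro!: AP_plus_subset AP_plus_mult f q)
  then show False by simp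
qed

text \<open>
  The quasi-inverse is \<open>f\<close> times the bounded function \<open>1 / (\<phi> f - f)\<close>, and \<open>A0\<close> is closed under
  such multipliers.
\<close>

lemma hom_contractive_A0:
  assumes f: "f \<in> A0" and B: "\<And>s. 0 \<le> Re s \<Longrightarrow> cmod (f s) \<le> B"
  shows "cmod (\<phi> f) \<le> B"
proof (rule ccontr)
  assume "\<not> cmod (\<phi> f) \<le> B"
  then have l: "B < cmod (\<phi> f)" by simp
  have B0: "0 \<le> B" using B [of 0] by (simp add: order_trans [OF norm_ge_zero])
  have gap: "cmod (\<phi> f) - B \<le> cmod (\<phi> f - f s)" if "0 \<le> Re s" for s
    using B [OF that] norm_triangle_ineq2 [of "\<phi> f" "f s"] by linarith
  then have ne: "\<phi> f - f s \<noteq> 0" if "0 \<le> Re s" for s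
    using l that by fastforce
  define q where "q = (\<lambda>s\<in>closed_rhp. f s * (1 / (\<phi> f - f s)))"
  have q: "q \<in> A0"
    unfolding q_def
  proof (rule A0_mult_bounded [OF f, where B = "1 / (cmod (\<phi> f) - B)"])
    show "(\<lambda>s. 1 / (\<phi> f - f s)) holomorphic_on open_rhp"
      by (intro holomorphic_intros A0_holomorphic [OF f] ne) simp
    show "continuous_on closed_rhp (\<lambda>s. 1 / (\<phi> f - f s))"
      by (intro continuous_intros A0_continuous [OF f] ballI ne) simp
    show "cmod (1 / (\<phi> f - f s)) \<le> 1 / (cmod (\<phi> f) - B)" if "0 \<le> Re s" for s
      unfolding norm_divide norm_one using gap [OF that] l by (intro frac_le) auto
  qed
  have "\<phi> f * q s = f s + f s * q s" if s: "0 \<le> Re s" for s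
    using s ne [OF s] by (simp add: q_def divide_simps) (simp add: algebra_simps)
  then have "\<phi> f \<noteq> \<phi> f"
    using B0 l by (rule_tac hom_avoids_quasi_inverse [where q = q])
      (auto intro!: A0_subset A0_mult f q)
  then show False by simp
qed

text \<open>
  It comes from \<open>1 / (s - w) - 1 / (s - v) = (w - v) / ((s - w) (s - v))\<close>, and ties all the values
  \<open>\<phi> (recip w)\<close> to the one at \<open>w = -1\<close>.
\<close>

lemma hom_resolvent_identity:
  assumes "Re w < 0" "Re v < 0"
  shows "\<phi> (recip w) - \<phi> (recip v) = (w - v) * \<phi> (recip w) * \<phi> (recip v)"
proof -
  note r = A0_recip [OF assms(1)] A0_recip [OF assms(2)]
  let ?P = "\<lambda>s\<in>closed_rhp. recip w s * recip v s"
  have "?P \<in> A0_AP_plus"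
    by (intro A0_subset A0_mult r)
  then have "\<phi> (recip w) = \<phi> (recip v) + (w - v) * \<phi> ?P"
  proof (rule hom_linear [OF A0_subset [OF r(2)]])
    fix s :: complex assume "0 \<le> Re s"
    moreover from this have "s \<noteq> w" "s \<noteq> v" using assms by auto
    ultimately show "recip w s = recip v s + (w - v) * ?P s"
      by (simp add: divide_simps) 
  qed simp
  also have "\<phi> ?P = \<phi> (recip w) * \<phi> (recip v)"
    by (intro hom_mult A0_subset r) auto
  finally show ?thesis by (metis add_diff_cancel_left' mult.assoc)
qed

text \<open>
  By contractivity, a value that \<open>\<phi>\<close> takes on arbitrarily small functions is 0.
\<close>

lemma hom_zero_if_approx:
  assumes "\<And>e. e > 0 \<Longrightarrow> \<exists>g\<in>A0. \<phi> g = z \<and> (\<forall>s. 0 \<le> Re s \<longrightarrow> cmod (g s) \<le> e)"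
  shows "z = 0"
proof (rule ccontr)
  assume "z \<noteq> 0"
  then obtain g where "g \<in> A0" "\<phi> g = z" "\<forall>s. 0 \<le> Re s \<longrightarrow> cmod (g s) \<le> cmod z / 2"
    using assms [of "cmod z / 2"] by auto
  then show False
    using hom_contractive_A0 [of g "cmod z / 2"] \<open>z \<noteq> 0\<close> by simp
qed

text \<open>
  This is the case of the point at infinity. By the resolvent identity \<open>\<phi>\<close> kills every
  resolvent, so \<open>f\<close> and \<open>f (s / (s + n)) = f - n f / (s + n)\<close> have the same value; the
  factor \<open>s / (s + n)\<close> has modulus at most 1 and, for large \<open>n\<close>, is small on the bounded region
  where \<open>f\<close> is not.
\<close>

lemma hom_vanishes_on_A0:
  assumes z: "\<phi> (recip (-1)) = 0" and f: "f \<in> A0"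
  shows "\<phi> f = 0"
proof (rule hom_zero_if_approx)
  fix e :: real assume "e > 0"
  obtain R where R: "R > 0" "\<And>s. \<lbrakk>0 \<le> Re s; R \<le> cmod s\<rbrakk> \<Longrightarrow> cmod (f s) < e"
    using A0_small_at_infinity [OF f \<open>e > 0\<close>] by blast
  obtain M where M: "\<And>s. 0 \<le> Re s \<Longrightarrow> cmod (f s) \<le> M"
    using A0_bounded [OF f] by blast
  have M0: "0 \<le> M" using M [of 0] by (simp add: order_trans [OF norm_ge_zero])
  \<comment> \<open>For \<open>\<bar>s\<bar> < R\<close> the factor \<open>s / (s + n)\<close> is at most \<open>R / n\<close>, so \<open>n \<ge> M R / e\<close> is needed.\<close>
  define n where "n = M * R / e + 1"
  have n: "n > 0" unfolding n_def using M0 R(1) \<open>e > 0\<close> by (simp add: add_nonneg_pos)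
  let ?w = "- complex_of_real n"
  have r: "recip ?w \<in> A0" using n by (intro A0_recip) simp
  let ?P = "\<lambda>s\<in>closed_rhp. f s * recip ?w s"
  have P: "?P \<in> A0" by (rule A0_mult [OF f r])
  have "\<phi> (recip ?w) = 0"
    using hom_resolvent_identity [of ?w "-1"] n z by simp
  then have P0: "\<phi> ?P = 0"
    using hom_mult [OF A0_subset [OF f] A0_subset [OF r], of ?P] by simp
  define g where "g = (\<lambda>s\<in>closed_rhp. f s + (\<lambda>s\<in>closed_rhp. - of_real n * ?P s) s)"
  have "g \<in> A0" unfolding g_def by (intro A0_add A0_cmult f P)
  moreover have "\<phi> g = \<phi> f"
    using hom_linear [OF A0_subset [OF f] A0_subset [OF P], of g "- of_real n"] P0
    by (simp add: g_def)
  moreover have "cmod (g s) \<le> e" if s: "0 \<le> Re s" for s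
  proof -
    have sn: "n \<le> cmod (s + of_real n)"
      using complex_Re_le_cmod [of "s + of_real n"] s by simp
    have "cmod s \<le> cmod (s + of_real n)"
      unfolding cmod_def using s n by (intro real_sqrt_le_mono add_mono) (auto intro!: power_mono)
    have ne: "s + of_real n \<noteq> 0" using sn n by auto
    have gs: "g s = f s * (s / (s + of_real n))"
      using s ne by (simp add: g_def divide_simps) (simp add: algebra_simps)
    show ?thesis
    proof (cases "R \<le> cmod s")
      case True
      have "cmod (g s) \<le> cmod (f s) * 1"
        unfolding gs norm_mult norm_divide
        using \<open>cmod s \<le> cmod (s + of_real n)\<close> sn n
        by (intro mult_left_mono) (auto simp: divide_le_eq_1)
      then show ?thesis using R(2) [OF s True] by simp
    next
      case False
      have "cmod (g s) \<le> M * (R / n)"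
        unfolding gs norm_mult norm_divide
        using False sn n M [OF s] M0 R(1) by (intro mult_mono frac_le) auto
      also have "\<dots> \<le> e"
        using n \<open>e > 0\<close> by (simp add: divide_le_eq) (simp add: n_def distrib_left)
      finally show ?thesis .
    qed
  qed
  ultimately show "\<exists>g\<in>A0. \<phi> g = \<phi> f \<and> (\<forall>s. 0 \<le> Re s \<longrightarrow> cmod (g s) \<le> e)"
    by blast
qed

text \<open>
  With \<open>q = f / (s - a)\<close>, the function \<open>f / (s + 1)\<close> equals \<open>q (1 - (a + 1) / (s + 1))\<close>, and
  \<open>\<phi>\<close> maps the second factor to \<open>1 - 1 = 0\<close>; the factor \<open>1 / (s + 1)\<close> on the left has nonzero
  value.
\<close>

lemma hom_zero_at_interior_root:
  assumes a: "\<phi> (recip (-1)) * (a + 1) = 1" and "0 < Re a" and f: "f \<in> A0" "f a = 0"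
  shows "\<phi> f = 0"
proof -
  define q where "q = (\<lambda>s\<in>closed_rhp. if s = a then deriv f a else f s / (s - a))"
  have q: "q \<in> A0" unfolding q_def using A0_divide_root f \<open>0 < Re a\<close> by blast
  have r: "recip (-1) \<in> A0" by (rule A0_recip) simp
  let ?F = "\<lambda>s\<in>closed_rhp. f s * recip (-1) s"
  let ?Q = "\<lambda>s\<in>closed_rhp. q s * recip (-1) s"
  have Q: "?Q \<in> A0" by (rule A0_mult [OF q r])
  have "\<phi> ?F = \<phi> q + (- (a + 1)) * \<phi> ?Q"
  proof (rule hom_linear [OF A0_subset [OF q] A0_subset [OF Q]])
    fix s :: complex assume s: "0 \<le> Re s"
    then have "s + 1 \<noteq> 0" by (auto simp: complex_eq_iff)
    moreover have "f s = q s * (s - a)"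
      using s f(2) by (simp add: q_def)
    ultimately show "?F s = q s + (- (a + 1)) * ?Q s"
      using s by (simp add: divide_simps) (simp add: algebra_simps)
  qed simp
  moreover have "\<phi> ?Q = \<phi> q * \<phi> (recip (-1))"
    by (rule hom_mult [OF A0_subset [OF q] A0_subset [OF r]]) auto
  ultimately have "\<phi> ?F = \<phi> q * (1 - \<phi> (recip (-1)) * (a + 1))"
    by (simp add: algebra_simps)
  moreover have "\<phi> ?F = \<phi> f * \<phi> (recip (-1))"
    by (rule hom_mult [OF A0_subset [OF f(1)] A0_subset [OF r]]) auto
  moreover have "\<phi> (recip (-1)) \<noteq> 0" using a by auto
  ultimately show ?thesis using a by simp
qed

text \<open>
  The quotient \<open>f / (s - a)\<close> may be unbounded near \<open>a\<close>. Instead \<open>f\<close> is multiplied by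
  \<open>x / (s - a + x)\<close> with small \<open>x > 0\<close>, whose value under \<open>\<phi>\<close> is 1 by the resolvent identity. Its
  modulus is at most 1, and it is small away from \<open>a\<close>; near \<open>a\<close> the function \<open>f\<close> is small.
\<close>

lemma hom_zero_at_boundary_root:
  assumes a: "\<phi> (recip (-1)) * (a + 1) = 1" and "Re a = 0" and f: "f \<in> A0" "f a = 0"
  shows "\<phi> f = 0"
proof (rule hom_zero_if_approx)
  fix e :: real assume "e > 0"
  have "continuous (at a within closed_rhp) f"
    using A0_continuous [OF f(1)] \<open>Re a = 0\<close> unfolding continuous_on_eq_continuous_within by simp
  then obtain d where d: "d > 0" "\<And>s. \<lbrakk>0 \<le> Re s; dist s a < d\<rbrakk> \<Longrightarrow> cmod (f s) < e"
    using \<open>e > 0\<close> f(2) unfolding continuous_within_eps_delta by force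
  obtain M where M: "\<And>s. 0 \<le> Re s \<Longrightarrow> cmod (f s) \<le> M"
    using A0_bounded [OF f(1)] by blast
  have M0: "0 \<le> M" using M [of 0] by (simp add: order_trans [OF norm_ge_zero])
  \<comment> \<open>At distance at least \<open>d\<close> from \<open>a\<close> the factor \<open>x / (s - a + x)\<close> is at most \<open>x / d\<close>.\<close>
  define x where "x = e * d / (M + 1)"
  have x: "x > 0" unfolding x_def using \<open>e > 0\<close> d(1) M0 by simp
  let ?w = "a - of_real x"
  have w: "Re ?w < 0" using x \<open>Re a = 0\<close> by simp
  have r: "recip ?w \<in> A0" by (rule A0_recip [OF w])
  have "\<phi> (recip ?w) - \<phi> (recip (-1)) = (?w + 1) * \<phi> (recip ?w) * \<phi> (recip (-1))"
    using hom_resolvent_identity [OF w, of "-1"] by simp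
  also have "\<dots> = \<phi> (recip ?w) * (\<phi> (recip (-1)) * (a + 1)) - of_real x * \<phi> (recip ?w) * \<phi> (recip (-1))"
    by (simp add: algebra_simps)
  finally have "\<phi> (recip (-1)) * (of_real x * \<phi> (recip ?w)) = \<phi> (recip (-1)) * 1"
    unfolding a by (simp add: algebra_simps)
  then have rx: "of_real x * \<phi> (recip ?w) = 1"
    using a by (metis mult_cancel_left mult_zero_left zero_neq_one)
  let ?P = "\<lambda>s\<in>closed_rhp. f s * recip ?w s"
  have P: "?P \<in> A0" by (rule A0_mult [OF f(1) r])
  define g where "g = (\<lambda>s\<in>closed_rhp. of_real x * ?P s)"
  have "g \<in> A0" unfolding g_def by (rule A0_cmult [OF P])
  moreover have "\<phi> g = \<phi> f"
  proof -
    have "\<phi> g = of_real x * \<phi> ?P"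
      unfolding g_def by (rule hom_cmult [OF A0_subset [OF P]])
    moreover have "\<phi> ?P = \<phi> f * \<phi> (recip ?w)"
      by (rule hom_mult [OF A0_subset [OF f(1)] A0_subset [OF r]]) auto
    ultimately show ?thesis using rx by (simp add: mult.left_commute)
  qed
  moreover have "cmod (g s) \<le> e" if s: "0 \<le> Re s" for s
  proof -
    have sx: "x \<le> cmod (s - ?w)"
      using complex_Re_le_cmod [of "s - ?w"] s \<open>Re a = 0\<close> by simp
    have gs: "cmod (g s) = cmod (f s) * (x / cmod (s - ?w))"
      using s x by (simp add: g_def norm_mult norm_divide)
    show ?thesis
    proof (cases "dist s a < d")
      case True
      have "cmod (g s) \<le> cmod (f s) * 1"
        unfolding gs using sx x by (intro mult_left_mono) (auto simp: divide_le_eq_1)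
      then show ?thesis using d(2) [OF s True] by simp
    next
      case False
      have "cmod (s - a) \<le> cmod (s - ?w)"
        unfolding cmod_def using s x \<open>Re a = 0\<close>
        by (intro real_sqrt_le_mono add_mono) (auto intro!: power_mono)
      with False have "d \<le> cmod (s - ?w)" by (simp add: dist_norm)
      then have "cmod (g s) \<le> M * (x / d)"
        unfolding gs using M [OF s] M0 d(1) x by (intro mult_mono frac_le) auto
      also have "\<dots> \<le> e"
        unfolding x_def using d(1) M0 \<open>e > 0\<close> by (simp add: divide_le_eq distrib_left)
      finally show ?thesis .
    qed
  qed
  ultimately show "\<exists>g\<in>A0. \<phi> g = \<phi> f \<and> (\<forall>s. 0 \<le> Re s \<longrightarrow> cmod (g s) \<le> e)"
    by blast
qed

lemma hom_is_evaluation: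
  assumes "f0 \<in> A0" "\<phi> f0 \<noteq> 0"
  shows "\<exists>a\<in>closed_rhp. \<forall>f\<in>A0_AP_plus. \<phi> f = f a"
proof -
  let ?z = "\<phi> (recip (-1))"
  have z: "?z \<noteq> 0" using hom_vanishes_on_A0 assms by blast
  define a where "a = 1 / ?z - 1"
  have a: "?z * (a + 1) = 1" unfolding a_def using z by simp
  have Re_a: "0 \<le> Re a"
  proof (rule ccontr)
    \<comment> \<open>Otherwise \<open>1 / (s - a)\<close> is in \<open>A0\<close>, and its resolvent identity with \<open>1 / (s + 1)\<close>
      forces \<open>?z = 0\<close>.\<close>
    assume "\<not> 0 \<le> Re a"
    then have "\<phi> (recip a) - ?z = \<phi> (recip a) * (?z * (a + 1))"
      using hom_resolvent_identity [of a "-1"] by (simp add: algebra_simps)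
    then show False using a z by simp
  qed
  then have a1: "a + 1 \<noteq> 0" using a by auto
  have r: "recip (-1) \<in> A0" by (rule A0_recip) simp
  have root: "\<phi> f = 0" if "f \<in> A0" "f a = 0" for f
    proof (cases "Re a = 0")
    case True
    then show ?thesis using hom_zero_at_boundary_root [OF a _ that] by blast
  next
    case False
    then show ?thesis using hom_zero_at_interior_root [OF a _ that] Re_a by simp
  qed
  have eval: "\<phi> f = f a" if f: "f \<in> A0" for f
  proof -
    \<comment> \<open>Subtract the multiple of \<open>1 / (s + 1)\<close> that has the same value at \<open>a\<close>; \<open>\<phi>\<close> is already
      known to evaluate \<open>1 / (s + 1)\<close> at \<open>a\<close>.\<close>
    define k where "k = (\<lambda>s\<in>closed_rhp. f s + (\<lambda>s\<in>closed_rhp. - (f a * (a + 1)) * recip (-1) s) s)"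
    have "k \<in> A0" unfolding k_def by (intro A0_add A0_cmult f r)
    moreover have "k a = 0" unfolding k_def using Re_a a1 by simp
    ultimately have "\<phi> k = 0" by (rule root)
    moreover have "\<phi> k = \<phi> f + - (f a * (a + 1)) * ?z"
      by (rule hom_linear [OF A0_subset [OF f] A0_subset [OF r]]) (simp_all add: k_def)
    ultimately have "\<phi> f = f a * (?z * (a + 1))" by (simp add: algebra_simps)
    then show ?thesis using a by simp
  qed
  have "\<phi> f = f a" if f: "f \<in> A0_AP_plus" for f
  proof -
    let ?k = "\<lambda>s\<in>closed_rhp. recip (-1) s * f s"
    have "\<phi> ?k = ?z * \<phi> f"
      by (rule hom_mult [OF A0_subset [OF r] f]) auto
    moreover have "\<phi> ?k = ?k a" by (rule eval [OF A0_mult_A0_AP_plus [OF r f]])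
    moreover have "?k a = recip (-1) a * f a" using Re_a by simp
    moreover have "recip (-1) a = ?z" by (rule eval [OF r, symmetric])
    ultimately show ?thesis using z by simp
  qed
  then show ?thesis using Re_a by auto
qed

end

section \<open>Multiplicative functions on the half line\<close>

text \<open>
  An additive nonnegative function on the half line is monotone, so \<open>L (n t)\<close> lies between the
  values of \<open>L\<close> at the two integers around \<open>n t\<close>. Hence \<open>n \<bar>L t - t L 1\<bar> \<le> L 1\<close> for all \<open>n\<close>.
\<close>

lemma additive_nonneg_imp_linear:
  fixes L :: "real \<Rightarrow> real"
  assumes add: "\<And>t u. \<lbrakk>0 \<le> t; 0 \<le> u\<rbrakk> \<Longrightarrow> L (t + u) = L t + L u"
    and nonneg: "\<And>t. 0 \<le> t \<Longrightarrow> 0 \<le> L t" and t: "0 \<le> t"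
  shows "L t = L 1 * t"
proof -
  have L0: "L 0 = 0" using add [of 0 0] by simp
  have mult: "L (real n * u) = real n * L u" if "0 \<le> u" for n u
  proof (induction n)
    case 0 then show ?case using L0 by simp
  next
    case (Suc n)
    have "L (real n * u + u) = L (real n * u) + L u" using that by (intro add) auto
    with Suc show ?case by (simp add: distrib_right add.commute)
  qed
  have mono: "L u \<le> L v" if "0 \<le> u" "u \<le> v" for u v
    using add [of u "v - u"] nonneg [of "v - u"] that by simp
  have bound: "real n * \<bar>L t - L 1 * t\<bar> \<le> L 1" for n
  proof -
    let ?k = "nat \<lfloor>real n * t\<rfloor>"
    have nt: "0 \<le> real n * t" using t by simp
    then have k: "real ?k \<le> real n * t" "real n * t \<le> real ?k + 1"
      by linarith+
    have "L (real ?k) \<le> L (real n * t)" "L (real n * t) \<le> L (real ?k + 1)"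
      using k nt by (auto intro: mono)
    moreover have "L (real ?k) = real ?k * L 1" using mult [of 1 ?k] by simp
    moreover have "L (real ?k + 1) = real ?k * L 1 + L 1"
      using add [of "real ?k" 1] \<open>L (real ?k) = real ?k * L 1\<close> by simp
    moreover have "L (real n * t) = real n * L t" by (rule mult [OF t])
    moreover have "real ?k * L 1 \<le> real n * t * L 1" "real n * t * L 1 \<le> (real ?k + 1) * L 1"
      using k nonneg [of 1] by (auto intro!: mult_right_mono)
    ultimately have "\<bar>real n * L t - real n * t * L 1\<bar> \<le> L 1"
      by (simp add: distrib_right abs_le_iff)
    also have "\<bar>real n * L t - real n * t * L 1\<bar> = real n * \<bar>L t - L 1 * t\<bar>"
      by (simp add: abs_mult [of "real n", simplified, symmetric] algebra_simps)
    finally show ?thesis .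
  qed
  show ?thesis
  proof (rule ccontr)
    assume "L t \<noteq> L 1 * t"
    then obtain n where "L 1 < real n * \<bar>L t - L 1 * t\<bar>"
      using reals_Archimedean3 [of "\<bar>L t - L 1 * t\<bar>"] by auto
    then show False using bound [of n] by simp
  qed
qed

text \<open>
  Polar decomposition: the modulus is an exponential because its negative logarithm is additive and
  nonnegative, and the phase extends from the half line to a character of the real line.
\<close>

lemma nonvanishing_contractive_multiplicative:
  fixes m :: "real \<Rightarrow> complex"
  assumes mult: "\<And>t u. \<lbrakk>0 \<le> t; 0 \<le> u\<rbrakk> \<Longrightarrow> m (t + u) = m t * m u"
    and le1: "\<And>t. 0 \<le> t \<Longrightarrow> cmod (m t) \<le> 1" and ne: "\<And>t. 0 \<le> t \<Longrightarrow> m t \<noteq> 0"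
  obtains \<sigma> \<xi> where "0 \<le> \<sigma>" "real_character \<xi>"
    "\<And>t. 0 \<le> t \<Longrightarrow> m t = of_real (exp (- (\<sigma> * t))) * \<xi> t"
proof -
  define L where "L = (\<lambda>t. - ln (cmod (m t)))"
  have L: "L t = L 1 * t" if "0 \<le> t" for t
  proof (rule additive_nonneg_imp_linear [OF _ _ that])
    show "L (t + u) = L t + L u" if "0 \<le> t" "0 \<le> u" for t u
      using mult [OF that] ne [OF that(1)] ne [OF that(2)] by (simp add: L_def norm_mult ln_mult)
    show "0 \<le> L t" if "0 \<le> t" for t
      using le1 [OF that] ne [OF that] by (simp add: L_def)
  qed
  define w where "w = (\<lambda>t. sgn (m t))"
  have w_mult: "w (t + u) = w t * w u" if "0 \<le> t" "0 \<le> u" for t u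
    using mult [OF that] by (simp add: w_def sgn_mult)
  have w1: "cmod (w t) = 1" if "0 \<le> t" for t
    using ne [OF that] by (simp add: w_def norm_sgn)
  then have w0: "w t \<noteq> 0" if "0 \<le> t" for t
    using that by (metis norm_zero zero_neq_one)
  \<comment> \<open>\<open>w\<close> is multiplicative on the half line, so it extends to a character of the group of its
    differences: \<open>t = max t 0 - max (- t) 0\<close>.\<close>
  define \<xi> where "\<xi> = (\<lambda>t. w (max t 0) / w (max (- t) 0))"
  have "real_character \<xi>"
    unfolding real_character_def
  proof (intro conjI allI)
    show "cmod (\<xi> t) = 1" for t
      by (simp add: \<xi>_def norm_divide w1)
    fix t u :: real
    have "w (max (t + u) 0 + (max (- t) 0 + max (- u) 0)) =
        w (max (- (t + u)) 0 + (max t 0 + max u 0))"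
      by (rule arg_cong [where f = w]) (simp add: max_def)
    then have "w (max (t + u) 0) * (w (max (- t) 0) * w (max (- u) 0)) =
        w (max (- (t + u)) 0) * (w (max t 0) * w (max u 0))"
      by (simp only: w_mult max.cobounded2 add_nonneg_nonneg)
    then show "\<xi> (t + u) = \<xi> t * \<xi> u"
      unfolding \<xi>_def times_divide_times_eq
      by (subst frac_eq_eq) (auto simp: w0 mult.commute simp del: minus_add_distrib)
  qed
  moreover have "m t = of_real (exp (- (L 1 * t))) * \<xi> t" if t: "0 \<le> t" for t
  proof -
    have "w 0 = 1" using w_mult [of 0 0] w0 [of 0] by simp
    then have "\<xi> t = w t" using t by (simp add: \<xi>_def max_def)
    moreover have "exp (- L t) = cmod (m t)"
      using ne [OF t] by (simp add: L_def)
    then have "exp (- (L 1 * t)) = cmod (m t)"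
      by (simp only: L [OF t])
    ultimately show ?thesis
      using ne [OF t] by (simp add: w_def sgn_div_norm scaleR_conv_of_real)
  qed
  moreover have "0 \<le> L 1" using le1 [of 1] ne [of 1] by (simp add: L_def)
  ultimately show ?thesis using that by blast
qed

text \<open>
  A zero at \<open>t0\<close> forces zeros at all larger arguments, in particular at some multiple \<open>n t\<close>, where
  the value is \<open>m t ^ n\<close>.
\<close>

lemma multiplicative_vanishing:
  fixes m :: "real \<Rightarrow> complex"
  assumes mult: "\<And>t u. \<lbrakk>0 \<le> t; 0 \<le> u\<rbrakk> \<Longrightarrow> m (t + u) = m t * m u"
    and t0: "0 \<le> t0" "m t0 = 0" and t: "0 < t"
  shows "m t = 0"
proof -
  obtain n where n: "t0 < real n * t"
    using reals_Archimedean3 [OF t] by blast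
  have zero: "m (real n * t) = 0"
    using mult [of t0 "real n * t - t0"] t0 n by simp
  have "m (real (Suc k) * t) = m t ^ Suc k" for k
  proof (induction k)
    case (Suc k)
    have "m (real (Suc k) * t + t) = m (real (Suc k) * t) * m t"
      using t by (intro mult) auto
    moreover have "real (Suc (Suc k)) * t = real (Suc k) * t + t"
      by (simp add: algebra_simps)
    ultimately show ?case using Suc by (simp only: power_Suc2)
  qed simp
  moreover have "n \<noteq> 0" using n t0(1) by (metis less_le_not_le mult_zero_left of_nat_0)
  ultimately show ?thesis
    using zero by (metis not0_implies_Suc power_eq_0_iff)
qed

section \<open>Twisted evaluation\<close>

text \<open>
  The extension by continuity is unique because exponential polynomials are dense in \<open>AP_plus\<close>.
\<close>

lemma twisted_eval_eqI:
  assumes "is_twisted_eval \<sigma> \<xi> \<Lambda>" shows "twisted_eval \<sigma> \<xi> = \<Lambda>"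
  unfolding twisted_eval_def
proof (rule the_equality [where P = "is_twisted_eval \<sigma> \<xi>", OF assms])
  fix \<Lambda>' assume \<Lambda>': "is_twisted_eval \<sigma> \<xi> \<Lambda>'"
  let ?X = "subtopology sup_norm_topology AP_plus"
  show "\<Lambda>' = \<Lambda>"
  proof (rule extensionalityI [of _ AP_plus])
    fix h assume h: "h \<in> AP_plus"
    show "\<Lambda>' h = \<Lambda> h"
    proof (rule forall_in_closure_of_eq [of h ?X exp_polys euclidean])
      have "?X closure_of exp_polys = AP_plus"
        using exp_polys_subset_AP_plus
        by (simp add: closure_of_subtopology Int_absorb1 subsetI flip: AP_plus_def)
      then show "h \<in> ?X closure_of exp_polys" using h by simp
      show "\<Lambda>' p = \<Lambda> p" if "p \<in> exp_polys" for p
        using that assms \<Lambda>' unfolding is_twisted_eval_def exp_polys_def by auto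
    qed (use assms \<Lambda>' in \<open>auto simp: is_twisted_eval_def\<close>)
  qed (use assms \<Lambda>' in \<open>auto simp: is_twisted_eval_def\<close>)
qed

section \<open>Means and limits of exponential polynomials\<close>

text \<open>
  The integral of the oscillating exponential is bounded by \<open>2 / \<bar>t\<bar>\<close> uniformly in \<open>T\<close>.
\<close>

lemma bohr_mean_exp:
  assumes "t \<noteq> 0"
  shows "((\<lambda>T. integral {-T..T} (\<lambda>\<omega>. exp (- (\<i> * of_real \<omega> * of_real t))) / of_real (2 * T))
    \<longlongrightarrow> (0 :: complex)) at_top"
proof (rule Lim_null_comparison)
  show "((\<lambda>T. (1 / \<bar>t\<bar>) / T) \<longlongrightarrow> 0) at_top"
    by (intro tendsto_divide_0 [OF tendsto_const] filterlim_at_top_imp_at_infinity filterlim_ident)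
  show "\<forall>\<^sub>F T in at_top. cmod (integral {-T..T}
      (\<lambda>\<omega>. exp (- (\<i> * of_real \<omega> * of_real t))) / of_real (2 * T)) \<le> (1 / \<bar>t\<bar>) / T"
    using eventually_gt_at_top [of 0]
  proof eventually_elim
    case (elim T)
    define E where "E = (\<lambda>\<omega>::real. \<i> * exp (- (\<i> * of_real \<omega> * of_real t)) / of_real t)"
    have "((\<lambda>\<omega>. exp (- (\<i> * of_real \<omega> * of_real t))) has_integral (E T - E (- T))) {-T..T}"
    proof (rule fundamental_theorem_of_calculus)
      fix \<omega> assume "\<omega> \<in> {-T..T}"
      have "((\<lambda>z. \<i> * exp (- (\<i> * z * of_real t)) / of_real t) has_field_derivative
          exp (- (\<i> * of_real \<omega> * of_real t))) (at (of_real \<omega>))"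
        using assms by (auto intro!: derivative_eq_intros simp: field_simps)
      then show "(E has_vector_derivative exp (- (\<i> * of_real \<omega> * of_real t)))
          (at \<omega> within {-T..T})"
        unfolding E_def by (rule has_vector_derivative_real_field)
    qed (use elim in simp)
    then have "integral {-T..T} (\<lambda>\<omega>. exp (- (\<i> * of_real \<omega> * of_real t))) = E T - E (- T)"
      by (rule integral_unique)
    moreover have "cmod (E x) = 1 / \<bar>t\<bar>" for x
      by (simp add: E_def norm_mult norm_divide norm_exp_eq_Re)
    then have "cmod (E T - E (- T)) \<le> 2 / \<bar>t\<bar>"
      using norm_triangle_ineq4 [of "E T" "E (- T)"] by simp
    ultimately have "cmod (integral {-T..T} (\<lambda>\<omega>. exp (- (\<i> * of_real \<omega> * of_real t)))) / (2 * T)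
        \<le> (2 / \<bar>t\<bar>) / (2 * T)"
      using elim by (intro divide_right_mono) simp_all
    then show ?case
      using elim by (simp add: norm_divide)
  qed
qed

lemma bohr_mean_exp_poly:
  assumes "finite K"
  shows "((\<lambda>T. integral {-T..T} (\<lambda>\<omega>. exp_poly K c (\<i> * of_real \<omega>)) / of_real (2 * T))
    \<longlongrightarrow> (\<Sum>t\<in>K. c t * (if t = 0 then 1 else 0))) at_top"
proof -
  have term_lim: "((\<lambda>T. integral {-T..T} (\<lambda>\<omega>. exp (- (\<i> * of_real \<omega> * of_real t))) / of_real (2 * T))
    \<longlongrightarrow> (if t = 0 then 1 else 0 :: complex)) at_top" for t
  proof (cases "t = 0")
    case True
    have "\<forall>\<^sub>F T in at_top. integral {-T..T} (\<lambda>\<omega>. exp (- (\<i> * of_real \<omega> * of_real t))) / of_real (2 * T) = (1::complex)"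
      using eventually_gt_at_top [of 0]
      by eventually_elim (simp add: True scaleR_conv_of_real)
    then show ?thesis using True by (simp add: tendsto_eventually)
  qed (use bohr_mean_exp in simp)
  have "((\<lambda>T. \<Sum>t\<in>K. c t * (integral {-T..T} (\<lambda>\<omega>. exp (- (\<i> * of_real \<omega> * of_real t))) / of_real (2 * T)))
    \<longlongrightarrow> (\<Sum>t\<in>K. c t * (if t = 0 then 1 else 0))) at_top"
    by (intro tendsto_sum tendsto_mult tendsto_const term_lim)
  moreover have "(\<Sum>t\<in>K. c t * (integral {-T..T} (\<lambda>\<omega>. exp (- (\<i> * of_real \<omega> * of_real t))) / of_real (2 * T)))
      = integral {-T..T} (\<lambda>\<omega>. exp_poly K c (\<i> * of_real \<omega>)) / of_real (2 * T)" for T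
  proof -
    have "integral {-T..T} (\<lambda>\<omega>. exp_poly K c (\<i> * of_real \<omega>))
        = (\<Sum>t\<in>K. integral {-T..T} (\<lambda>\<omega>. c t * exp (- (\<i> * of_real \<omega> * of_real t))))"
      proof -
      have "0 \<le> Re (\<i> * of_real \<omega>)" for \<omega> by simp
      then show ?thesis
        by (simp only: exp_poly_apply)
          (intro integral_sum assms integrable_continuous_real continuous_intros)
    qed
    then show ?thesis
      by (simp add: sum_divide_distrib)
  qed
  ultimately show ?thesis by simp
qed

lemma real_limit_exp_poly:
  assumes "finite K" "K \<subseteq> {0..}"
  shows "((\<lambda>x::real. exp_poly K c (of_real x)) \<longlongrightarrow> (\<Sum>t\<in>K. c t * (if t = 0 then 1 else 0))) at_top"
proof -
  have "((\<lambda>x::real. exp (- (of_real x * of_real t))) \<longlongrightarrow> (if t = 0 then 1 else 0 :: complex)) at_top"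
    if "t \<in> K" for t
  proof (cases "t = 0")
    case False
    then have "0 < t" using that assms(2) by auto
    then have "((\<lambda>x. exp (- (x * t))) \<longlongrightarrow> 0) at_top"
      by (intro filterlim_compose [OF exp_at_bot] filterlim_compose [OF filterlim_uminus_at_bot_at_top]
          filterlim_at_top_mult_tendsto_pos [OF tendsto_const] filterlim_ident)
    then have "((\<lambda>x. complex_of_real (exp (- (x * t)))) \<longlongrightarrow> of_real 0) at_top"
      by (rule tendsto_of_real)
    then show ?thesis using False by (simp flip: exp_of_real)
  qed simp
  then have "((\<lambda>x::real. \<Sum>t\<in>K. c t * exp (- (of_real x * of_real t)))
      \<longlongrightarrow> (\<Sum>t\<in>K. c t * (if t = 0 then 1 else 0))) at_top"
    by (intro tendsto_sum tendsto_mult tendsto_const)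
  moreover have "\<forall>\<^sub>F x in at_top. (\<Sum>t\<in>K. c t * exp (- (of_real x * of_real t)))
      = exp_poly K c (of_real x)"
    using eventually_ge_at_top [of "0::real"] by eventually_elim (simp add: exp_poly_apply)
  ultimately show ?thesis by (rule Lim_transform_eventually)
qed

lemma bohr_mean_diff_le:
  assumes h: "continuous_on closed_rhp h" and k: "continuous_on closed_rhp k"
    and e: "\<And>s. 0 \<le> Re s \<Longrightarrow> cmod (h s - k s) \<le> e" and "0 < T"
  shows "dist (integral {-T..T} (\<lambda>\<omega>. h (\<i> * of_real \<omega>)) / of_real (2 * T))
    (integral {-T..T} (\<lambda>\<omega>. k (\<i> * of_real \<omega>)) / of_real (2 * T)) \<le> e"
proof -
  have cont: "continuous_on {-T..T} (\<lambda>\<omega>. f (\<i> * of_real \<omega>))"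
    if "continuous_on closed_rhp f" for f :: "complex \<Rightarrow> complex"
    by (rule continuous_on_compose2 [OF that]) (auto intro!: continuous_intros)
  have "integral {-T..T} (\<lambda>\<omega>. h (\<i> * of_real \<omega>)) - integral {-T..T} (\<lambda>\<omega>. k (\<i> * of_real \<omega>))
      = integral {-T..T} (\<lambda>\<omega>. h (\<i> * of_real \<omega>) - k (\<i> * of_real \<omega>))"
    by (intro integral_diff [symmetric] integrable_continuous_real cont h k)
  moreover have "cmod (integral {-T..T} (\<lambda>\<omega>. h (\<i> * of_real \<omega>) - k (\<i> * of_real \<omega>))) \<le> e * (T - - T)"
    using \<open>0 < T\<close> by (intro integral_bound continuous_on_diff cont h k) (auto intro: e)
  ultimately show ?thesis
    using \<open>0 < T\<close> by (simp add: dist_norm norm_divide field_simps flip: diff_divide_distrib)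
qed

lemma tendsto_by_approximation:
  fixes f :: "'a \<Rightarrow> complex"
  assumes "\<And>e. e > 0 \<Longrightarrow> \<exists>p l'. (p \<longlongrightarrow> l') F \<and> (\<forall>\<^sub>F x in F. dist (f x) (p x) \<le> e) \<and> dist l l' \<le> e"
  shows "(f \<longlongrightarrow> l) F"
  unfolding tendsto_iff
proof (intro allI impI)
  fix e :: real assume "e > 0"
  then have e3: "e / 3 > 0" by simp
  obtain p l' where p: "(p \<longlongrightarrow> l') F" "\<forall>\<^sub>F x in F. dist (f x) (p x) \<le> e / 3" "dist l l' \<le> e / 3"
    using assms [OF e3] by blast
  have "\<forall>\<^sub>F x in F. dist (p x) l' < e / 3"
    using p(1) e3 unfolding tendsto_iff by blast
  with p(2) show "\<forall>\<^sub>F x in F. dist (f x) l < e"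
  proof eventually_elim
    case (elim x)
    have "dist (f x) l \<le> dist (f x) (p x) + (dist (p x) l' + dist l l')"
      by (meson add_left_mono dist_triangle dist_triangle2 order_trans)
    with elim p(3) show ?case by simp
  qed
qed

section \<open>Homomorphisms vanishing on the ideal \<open>A0\<close>\<close>

definition exp_monomial :: "real \<Rightarrow> complex \<Rightarrow> complex" where
  "exp_monomial t = (\<lambda>s\<in>closed_rhp. exp (- (s * of_real t)))"

lemma exp_monomial_apply [simp]: "0 \<le> Re s \<Longrightarrow> exp_monomial t s = exp (- (s * of_real t))"
  by (simp add: exp_monomial_def)

lemma exp_monomial_extensional [simp]: "exp_monomial t \<in> extensional closed_rhp"
  by (simp add: exp_monomial_def)

lemma exp_monomial_AP_plus: "0 \<le> t \<Longrightarrow> exp_monomial t \<in> AP_plus"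
  using exp_polys_monomial [of t 1] by (simp add: exp_monomial_def exp_polys_subset_AP_plus)

context
  fixes \<phi> :: "(complex \<Rightarrow> complex) \<Rightarrow> complex"
  assumes hom: "nonzero_hom closed_rhp A0_AP_plus \<phi>"
begin

lemma hom_lipschitz_AP_plus:
  assumes h: "h \<in> AP_plus" and k: "k \<in> AP_plus"
    and e: "\<And>s. 0 \<le> Re s \<Longrightarrow> cmod (h s - k s) \<le> e"
  shows "dist (\<phi> h) (\<phi> k) \<le> e"
proof -
  define d where "d = (\<lambda>s\<in>closed_rhp. h s + (\<lambda>s\<in>closed_rhp. (-1) * k s) s)"
  have "d \<in> AP_plus" unfolding d_def by (intro AP_plus_add AP_plus_cmult h k)
  moreover have "cmod (d s) \<le> e" if "0 \<le> Re s" for s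
    using e [OF that] that by (simp add: d_def)
  ultimately have "cmod (\<phi> d) \<le> e" by (rule hom_contractive_AP_plus [OF hom])
  moreover have "\<phi> d = \<phi> h + (-1) * \<phi> k"
    by (rule hom_linear [OF hom AP_plus_subset [OF h] AP_plus_subset [OF k]])
      (simp_all add: d_def)
  ultimately show ?thesis by (simp add: dist_norm)
qed

lemma hom_exp_monomial_add:
  assumes "0 \<le> t" "0 \<le> u"
  shows "\<phi> (exp_monomial (t + u)) = \<phi> (exp_monomial t) * \<phi> (exp_monomial u)"
  using assms
  by (intro hom_mult [OF hom] AP_plus_subset exp_monomial_AP_plus)
    (simp_all add: distrib_left flip: exp_add)

lemma hom_exp_monomial_zero: "\<phi> (exp_monomial 0) = 1"
proof -
  have "exp_monomial 0 = (\<lambda>s\<in>closed_rhp. 1)"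
    unfolding exp_monomial_def by (rule restrict_ext) simp
  then show ?thesis using hom_one [OF hom] by (simp only:)
qed

lemma hom_exp_monomial_le: "0 \<le> t \<Longrightarrow> cmod (\<phi> (exp_monomial t)) \<le> 1"
  by (intro hom_contractive_AP_plus [OF hom] exp_monomial_AP_plus)
    (simp_all add: norm_exp_monomial_le)

lemma hom_exp_poly:
  assumes "finite K" "K \<subseteq> {0..}"
  shows "\<phi> (exp_poly K c) = (\<Sum>t\<in>K. c t * \<phi> (exp_monomial t))"
  using assms
proof (induction K rule: finite_induct)
  case empty
  have "exp_poly {} c \<in> A0_AP_plus"
    by (intro AP_plus_subset exp_polys_subset_AP_plus exp_polysI) auto
  moreover from this have "\<phi> (exp_poly {} c) = \<phi> (exp_poly {} c) + \<phi> (exp_poly {} c) * 1"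
    using hom_linear [OF hom, of "exp_poly {} c" "exp_poly {} c" "exp_poly {} c" 1]
      A0_AP_plus_extensional by (simp add: exp_poly_apply)
  ultimately show ?case by simp
next
  case (insert t K)
  then have "exp_poly K c \<in> AP_plus" "exp_monomial t \<in> AP_plus" "exp_poly (insert t K) c \<in> AP_plus"
    by (auto intro!: exp_polys_subset_AP_plus exp_polysI exp_monomial_AP_plus)
  then have "\<phi> (exp_poly (insert t K) c) = \<phi> (exp_poly K c) + c t * \<phi> (exp_monomial t)"
    using insert.hyps
    by (intro hom_linear [OF hom] AP_plus_subset AP_plus_extensional) (simp_all add: exp_poly_apply)
  with insert show ?case by simp
qed

lemma hom_sum:
  assumes g: "g \<in> A0" and h: "h \<in> AP_plus" and "\<phi> g = 0"
  shows "\<phi> (\<lambda>s\<in>closed_rhp. g s + h s) = \<phi> h"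
proof -
  have "\<phi> (\<lambda>s\<in>closed_rhp. g s + h s) = \<phi> g + 1 * \<phi> h"
    by (rule hom_linear [OF hom A0_subset [OF g] AP_plus_subset [OF h]]) auto
  then show ?thesis using assms(3) by (simp only: mult_1 add_0)
qed

text \<open>
  The restriction of \<open>\<phi>\<close> is itself the extension by continuity, because \<open>\<phi>\<close> is a contraction.
\<close>

lemma hom_is_twisted_eval:
  assumes m: "\<And>t. 0 \<le> t \<Longrightarrow> \<phi> (exp_monomial t) = of_real (exp (- (\<sigma> * t))) * \<xi> t"
  shows "is_twisted_eval \<sigma> \<xi> (restrict \<phi> AP_plus)"
  unfolding is_twisted_eval_def
proof (intro conjI allI impI)
  let ?M = "funspace closed_rhp (euclidean_metric :: complex metric)"
  have ext: "AP_plus \<subseteq> mspace ?M"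
    using AP_plus_extensional AP_plus_bounded unfolding mspace_rhp_iff subset_iff by metis
  have "Lipschitz_continuous_map (submetric ?M AP_plus) euclidean_metric (restrict \<phi> AP_plus)"
    unfolding Lipschitz_continuous_map_def
  proof (intro conjI exI [of _ 1] ballI)
    fix h k assume "h \<in> mspace (submetric ?M AP_plus)" "k \<in> mspace (submetric ?M AP_plus)"
    then have hk: "h \<in> AP_plus" "k \<in> AP_plus"
      unfolding mspace_submetric by blast+
    then have "dist (\<phi> h) (\<phi> k) \<le> mdist ?M h k"
      using ext by (intro hom_lipschitz_AP_plus norm_diff_le_mdist_rhp) auto
    with hk show "mdist euclidean_metric (restrict \<phi> AP_plus h) (restrict \<phi> AP_plus k)
        \<le> 1 * mdist (submetric ?M AP_plus) h k"
      unfolding mdist_submetric mdist_euclidean_metric by (simp del: mdist_funspace)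
  qed simp
  then show "continuous_map (subtopology sup_norm_topology AP_plus) euclidean (restrict \<phi> AP_plus)"
    unfolding sup_norm_topology_def
    using Lipschitz_continuous_imp_continuous_map mtopology_of_submetric mtopology_of_euclidean
    by metis
  fix K :: "real set" and c assume K: "finite K \<and> K \<subseteq> {0..}"
  then have "exp_poly K c \<in> AP_plus"
    by (intro exp_polys_subset_AP_plus exp_polysI) auto
  then have "restrict \<phi> AP_plus (exp_poly K c) = (\<Sum>t\<in>K. c t * \<phi> (exp_monomial t))"
    using hom_exp_poly K by simp
  also have "\<dots> = (\<Sum>t\<in>K. c t * of_real (exp (- (\<sigma> * t))) * \<xi> t)"
    using K by (intro sum.cong) (auto simp: m mult.assoc)
  finally show "restrict \<phi> AP_plus (exp_poly K c)
      = (\<Sum>t\<in>K. c t * of_real (exp (- (\<sigma> * t))) * \<xi> t)" .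
qed simp

lemma hom_eq_twisted_eval:
  assumes A0: "\<And>g. g \<in> A0 \<Longrightarrow> \<phi> g = 0" and ne: "\<And>t. 0 \<le> t \<Longrightarrow> \<phi> (exp_monomial t) \<noteq> 0"
  shows "\<exists>\<sigma>\<ge>0. \<exists>\<xi>. real_character \<xi> \<and>
     (\<forall>g\<in>A0. \<forall>h\<in>AP_plus. \<phi> (\<lambda>s\<in>closed_rhp. g s + h s) = twisted_eval \<sigma> \<xi> h)"
proof -
  obtain \<sigma> \<xi> where \<sigma>: "0 \<le> \<sigma>" "real_character \<xi>"
    and m: "\<And>t. 0 \<le> t \<Longrightarrow> \<phi> (exp_monomial t) = of_real (exp (- (\<sigma> * t))) * \<xi> t"
    using nonvanishing_contractive_multiplicative [of "\<lambda>t. \<phi> (exp_monomial t)"]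
      hom_exp_monomial_add hom_exp_monomial_le ne by metis
  have "twisted_eval \<sigma> \<xi> = restrict \<phi> AP_plus"
    by (rule twisted_eval_eqI [OF hom_is_twisted_eval [OF m]])
  then have "\<phi> (\<lambda>s\<in>closed_rhp. g s + h s) = twisted_eval \<sigma> \<xi> h" if "g \<in> A0" "h \<in> AP_plus" for g h
    using hom_sum [OF that A0 [OF that(1)]] that(2) by (simp only: restrict_apply')
  with \<sigma> show ?thesis by blast
qed

context
  assumes vanish: "\<And>t. 0 < t \<Longrightarrow> \<phi> (exp_monomial t) = 0"
begin

lemma hom_exp_poly_constant_term:
  assumes "finite K" "K \<subseteq> {0..}"
  shows "\<phi> (exp_poly K c) = (\<Sum>t\<in>K. c t * (if t = 0 then 1 else 0))"
  unfolding hom_exp_poly [OF assms]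
  using assms(2) by (intro sum.cong) (auto simp: vanish hom_exp_monomial_zero)

text \<open>
  On exponential polynomials both sides are the constant coefficient. The means and \<open>\<phi>\<close> are
  contractions for the supremum norm, so the equality passes to uniform limits; the same argument
  gives the limit along the real axis.
\<close>

lemma fourier_coeff_zero_eq_hom:
  assumes h: "h \<in> AP_plus" shows "fourier_coeff h 0 = \<phi> h"
proof -
  have "((\<lambda>T. integral {-T..T} (\<lambda>\<omega>. h (\<i> * of_real \<omega>)) / of_real (2 * T)) \<longlongrightarrow> \<phi> h) at_top"
  proof (rule tendsto_by_approximation)
    fix e :: real assume "e > 0"
    obtain p where p: "p \<in> exp_polys" "\<And>s. 0 \<le> Re s \<Longrightarrow> cmod (h s - p s) \<le> e"
      using AP_plus_approx [OF h \<open>e > 0\<close>] by blast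
    then obtain K c where K: "finite K" "K \<subseteq> {0..}" and p_eq: "p = exp_poly K c"
      unfolding exp_polys_def by blast
    have "\<forall>\<^sub>F T in at_top. dist (integral {-T..T} (\<lambda>\<omega>. h (\<i> * of_real \<omega>)) / of_real (2 * T))
        (integral {-T..T} (\<lambda>\<omega>. p (\<i> * of_real \<omega>)) / of_real (2 * T)) \<le> e"
      using eventually_gt_at_top [of 0]
      by eventually_elim
        (rule bohr_mean_diff_le [OF AP_plus_continuous [OF h] exp_polys_continuous [OF p(1)] p(2)])
    moreover have "((\<lambda>T. integral {-T..T} (\<lambda>\<omega>. p (\<i> * of_real \<omega>)) / of_real (2 * T)) \<longlongrightarrow> \<phi> p) at_top"
      unfolding p_eq hom_exp_poly_constant_term [OF K] by (rule bohr_mean_exp_poly [OF K(1)])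
    moreover have "dist (\<phi> h) (\<phi> p) \<le> e"
      by (rule hom_lipschitz_AP_plus [OF h exp_polys_subset_AP_plus [OF p(1)] p(2)])
    ultimately show "\<exists>q l'. (q \<longlongrightarrow> l') at_top \<and>
        (\<forall>\<^sub>F T in at_top. dist (integral {-T..T} (\<lambda>\<omega>. h (\<i> * of_real \<omega>)) / of_real (2 * T)) (q T) \<le> e) \<and>
        dist (\<phi> h) l' \<le> e"
      by blast
  qed
  then show ?thesis
    unfolding fourier_coeff_def by (simp add: tendsto_Lim)
qed

lemma real_limit_AP_plus_eq_hom:
  assumes h: "h \<in> AP_plus" shows "((\<lambda>x::real. h (of_real x)) \<longlongrightarrow> \<phi> h) at_top"
proof (rule tendsto_by_approximation)
  fix e :: real assume "e > 0"
  obtain p where p: "p \<in> exp_polys" "\<And>s. 0 \<le> Re s \<Longrightarrow> cmod (h s - p s) \<le> e"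
    using AP_plus_approx [OF h \<open>e > 0\<close>] by blast
  then obtain K c where K: "finite K" "K \<subseteq> {0..}" and p_eq: "p = exp_poly K c"
    unfolding exp_polys_def by blast
  have "\<forall>\<^sub>F x in at_top. dist (h (complex_of_real x)) (p (of_real x)) \<le> e"
    using eventually_ge_at_top [of "0::real"]
    by eventually_elim (simp add: dist_norm p(2))
  moreover have "((\<lambda>x::real. p (of_real x)) \<longlongrightarrow> \<phi> p) at_top"
    unfolding p_eq hom_exp_poly_constant_term [OF K] by (rule real_limit_exp_poly [OF K])
  moreover have "dist (\<phi> h) (\<phi> p) \<le> e"
    by (rule hom_lipschitz_AP_plus [OF h exp_polys_subset_AP_plus [OF p(1)] p(2)])
  ultimately show "\<exists>q l'. (q \<longlongrightarrow> l') at_top \<and>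
      (\<forall>\<^sub>F x in at_top. dist (h (complex_of_real x)) (q x) \<le> e) \<and> dist (\<phi> h) l' \<le> e"
    by blast
qed

end

end

lemma A0_real_limit:
  assumes "g \<in> A0" shows "((\<lambda>x::real. g (of_real x)) \<longlongrightarrow> 0) at_top"
  unfolding tendsto_iff
proof (intro allI impI)
  fix e :: real assume "e > 0"
  then obtain R where R: "R > 0" "\<And>s. \<lbrakk>0 \<le> Re s; R \<le> cmod s\<rbrakk> \<Longrightarrow> cmod (g s) < e"
    using A0_small_at_infinity [OF assms] by blast
  show "\<forall>\<^sub>F x in at_top. dist (g (complex_of_real x)) 0 < e"
    using eventually_ge_at_top [of R] by eventually_elim (use R in simp)
qed

lemma hom_eq_plus_infinity:
  assumes hom: "nonzero_hom closed_rhp A0_AP_plus \<phi>" and ext: "\<phi> \<in> extensional A0_AP_plus"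
    and A0: "\<And>g. g \<in> A0 \<Longrightarrow> \<phi> g = 0" and vanish: "\<And>t. 0 < t \<Longrightarrow> \<phi> (exp_monomial t) = 0"
  shows "\<phi> = plus_infinity \<and>
     (\<forall>g\<in>A0. \<forall>h\<in>AP_plus.
        ((\<lambda>x::real. g (of_real x) + h (of_real x)) \<longlongrightarrow> fourier_coeff h 0) at_top \<and>
        \<phi> (\<lambda>s\<in>closed_rhp. g s + h s) = fourier_coeff h 0)"
proof (intro conjI ballI)
  have lim: "((\<lambda>x::real. g (of_real x) + h (of_real x)) \<longlongrightarrow> \<phi> h) at_top"
    if "g \<in> A0" "h \<in> AP_plus" for g h
    using tendsto_add [OF A0_real_limit [OF that(1)] real_limit_AP_plus_eq_hom [OF hom vanish that(2)]]
    by simp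
  fix g h assume gh: "g \<in> A0" "h \<in> AP_plus"
  have fc: "fourier_coeff h 0 = \<phi> h"
    by (rule fourier_coeff_zero_eq_hom [OF hom vanish gh(2)])
  show "((\<lambda>x::real. g (of_real x) + h (of_real x)) \<longlongrightarrow> fourier_coeff h 0) at_top"
    unfolding fc by (rule lim [OF gh])
  show "\<phi> (\<lambda>s\<in>closed_rhp. g s + h s) = fourier_coeff h 0"
    unfolding fc by (rule hom_sum [OF hom gh A0 [OF gh(1)]])
next
  show "\<phi> = plus_infinity"
  proof (rule extensionalityI [OF ext])
    show "plus_infinity \<in> extensional A0_AP_plus"
      by (simp add: plus_infinity_def)
    fix f assume f: "f \<in> A0_AP_plus"
    then obtain g h where gh: "g \<in> A0" "h \<in> AP_plus" and f_eq: "f = (\<lambda>s\<in>closed_rhp. g s + h s)"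
      by (rule A0_AP_plusE)
    have "((\<lambda>x::real. g (of_real x) + h (of_real x)) \<longlongrightarrow> 0 + \<phi> h) at_top"
      by (intro tendsto_add A0_real_limit real_limit_AP_plus_eq_hom [OF hom vanish] gh)
    moreover have "\<forall>\<^sub>F x in at_top. g (complex_of_real x) + h (of_real x) = f (of_real x)"
      using eventually_ge_at_top [of "0::real"] by eventually_elim (simp add: f_eq)
    ultimately have "((\<lambda>x::real. f (of_real x)) \<longlongrightarrow> 0 + \<phi> h) at_top"
      by (rule Lim_transform_eventually)
    then have "Lim at_top (\<lambda>x::real. f (of_real x)) = \<phi> h"
      by (simp add: tendsto_Lim)
    moreover have "\<phi> f = \<phi> h"
      unfolding f_eq by (rule hom_sum [OF hom gh A0 [OF gh(1)]])
    ultimately show "\<phi> f = plus_infinity f"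
      using f by (simp add: plus_infinity_def)
  qed
qed

section \<open>The maximal ideal space\<close>

theorem theorem3p2:
  fixes \<phi> :: "(complex \<Rightarrow> complex) \<Rightarrow> complex"
  assumes "\<phi> \<in> topspace (maximal_ideal_space closed_rhp A0_AP_plus)"
  shows "(\<exists>s\<in>closed_rhp. \<forall>f\<in>A0_AP_plus. \<phi> f = f s) \<or>
    (\<phi> = plus_infinity \<and>
     (\<forall>g\<in>A0. \<forall>h\<in>AP_plus.
        ((\<lambda>x::real. g (of_real x) + h (of_real x)) \<longlongrightarrow> fourier_coeff h 0) at_top \<and>
        \<phi> (\<lambda>s\<in>closed_rhp. g s + h s) = fourier_coeff h 0)) \<or>
    (\<exists>\<sigma>\<ge>0. \<exists>\<xi>. real_character \<xi> \<and>
     (\<forall>g\<in>A0. \<forall>h\<in>AP_plus.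
        \<phi> (\<lambda>s\<in>closed_rhp. g s + h s) = twisted_eval \<sigma> \<xi> h))"
proof -
  have hom: "nonzero_hom closed_rhp A0_AP_plus \<phi>" and ext: "\<phi> \<in> extensional A0_AP_plus"
    using assms by (auto simp: maximal_ideal_space_def PiE_def)
  show ?thesis
  proof (cases "\<exists>g\<in>A0. \<phi> g \<noteq> 0")
    case True
    then show ?thesis using hom_is_evaluation [OF hom] by blast
  next
    case False
    then have A0: "\<And>g. g \<in> A0 \<Longrightarrow> \<phi> g = 0" by blast
    show ?thesis
    proof (cases "\<exists>t\<ge>0. \<phi> (exp_monomial t) = 0")
      case True
      then obtain t0 where t0: "0 \<le> t0" "\<phi> (exp_monomial t0) = 0" by blast
      have "\<phi> (exp_monomial t) = 0" if "0 < t" for t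
        by (rule multiplicative_vanishing [of "\<lambda>t. \<phi> (exp_monomial t)",
              OF hom_exp_monomial_add [OF hom] t0 that])
      then show ?thesis
        using hom_eq_plus_infinity [OF hom ext A0] by blast
    next
      case False
      then show ?thesis
        using hom_eq_twisted_eval [OF hom A0] by blast
    qed
  qed
qed

end
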